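(* Let $\kappa,\tau\in\mathbb{R}$ with $\tau\neq0$ and $\kappa-4\tau^2\ne0$. There are no totally umbilic surfaces in $\mathbb{E}^*(\kappa,\tau)$.
   Context: $\mathbb{E}^*(\kappa,\tau)$ ($\tau\neq0$, $\kappa-4\tau^2\ne0$) denotes the simply connected 3-dimensional homogeneous Riemannian manifold with 4-dimensional isometry group which is a Riemannian fibration, with geodesic fibers and bundle curvature $\tau$, over the simply connected surface $\mathbb{M}^2(\kappa)$ of constant curvature $\kappa$. The unit vertical field $\xi$ is a Killing field with $\nabla_X\xi=\tau\,X\wedge\xi$ (cross product). There is a local direct orthonormal frame $\{e_1,e_2,e_3=\xi\}$ whose Christoffel symbols $\Gamma_{ij}^k=\langle\nabla_{e_i}e_j,e_k\rangle$ are $$\Gamma_{12}^3=\Gamma_{23}^1=-\Gamma_{21}^3=-\Gamma_{13}^2=\tau,\qquad \Gamma_{32}^1=-\Gamma_{31}^2=\tau-\frac{\kappa}{2\tau},$$ and $\Gamma_{ii}^i=\Gamma_{ij}^i=\Gamma_{ji}^i=\Gamma_{ii}^j=0$ for all $i,j\in\{1,2,3\}$. A surface is a (nonempty, not necessarily complete) isometrically immersed Riemannian surface $M^2$ in $\mathbb{E}^*(\kappa,\tau)$. It is totally umbilic if its shape operator $E$ satisfies $E=H\,\mathrm{Id}$ at every point, where $H=\frac12\mathrm{tr}(E)$ is the mean curvature function. *)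

theory Defs
  imports "HOL-Analysis.Analysis"
begin

section \<open>Smooth maps between open subsets of Euclidean spaces\<close>

abbreviation Der :: "('v::real_normed_vector \<Rightarrow> 'w::real_normed_vector) \<Rightarrow> 'v \<Rightarrow> 'v \<Rightarrow> 'w"
  where "Der f u \<equiv> frechet_derivative f (at u)"

text \<open>Meant for open sets \<open>U\<close> of finite-dimensional spaces.\<close>

primrec Ck_on :: "nat \<Rightarrow> 'v::real_normed_vector set \<Rightarrow> ('v \<Rightarrow> 'w::real_normed_vector) \<Rightarrow> bool" where
  "Ck_on 0 U f \<longleftrightarrow> continuous_on U f"
| "Ck_on (Suc k) U f \<longleftrightarrow>
     (\<forall>u\<in>U. f differentiable (at u)) \<and> (\<forall>v. Ck_on k U (\<lambda>u. Der f u v))"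

definition smooth_on :: "'v::real_normed_vector set \<Rightarrow> ('v \<Rightarrow> 'w::real_normed_vector) \<Rightarrow> bool"
  where "smooth_on U f \<longleftrightarrow> (\<forall>k. Ck_on k U f)"

section \<open>Riemannian geometry in one coordinate domain\<close>

text \<open>A metric on a coordinate domain is given by its Gram matrix as a function of the
  coordinates.\<close>

type_synonym 'n gram = "real^'n \<Rightarrow> real^'n^'n"

definition ip :: "real^'n^'n \<Rightarrow> real^'n \<Rightarrow> real^'n \<Rightarrow> real"
  where "ip A v w = v \<bullet> (A *v w)"

definition christoffel_symbol :: "'n::finite gram \<Rightarrow> real^'n \<Rightarrow> 'n \<Rightarrow> 'n \<Rightarrow> 'n \<Rightarrow> real"
  where "christoffel_symbol G u i j k =
    (\<Sum>l\<in>UNIV. matrix_inv (G u) $ k $ l *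
       (Der G u (axis i 1) $ j $ l + Der G u (axis j 1) $ i $ l - Der G u (axis l 1) $ i $ j)) / 2"

definition christoffel :: "'n::finite gram \<Rightarrow> real^'n \<Rightarrow> real^'n \<Rightarrow> real^'n \<Rightarrow> real^'n"
  where "christoffel G u v w =
    (\<chi> k. \<Sum>i\<in>UNIV. \<Sum>j\<in>UNIV. christoffel_symbol G u i j k * v $ i * w $ j)"

text \<open>The Levi-Civita derivative \<open>\<nabla>\<^sub>v X\<close> at the point with coordinates \<open>u\<close>, for a vector field \<open>X\<close>
  along a map \<open>F\<close> into the coordinate domain (\<open>v\<close> is tangent to the source of \<open>F\<close>).  For \<open>F\<close> the
  identity this is the covariant derivative of an ordinary vector field.\<close>

definition cov_along ::
    "'n::finite gram \<Rightarrow> (real^'m \<Rightarrow> real^'n) \<Rightarrow> (real^'m \<Rightarrow> real^'n) \<Rightarrow> real^'m \<Rightarrow> real^'m \<Rightarrow> real^'n"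
  where "cov_along G F X u v = Der X u v + christoffel G (F u) (Der F u v) (X u)"

definition cov :: "'n::finite gram \<Rightarrow> (real^'n \<Rightarrow> real^'n) \<Rightarrow> real^'n \<Rightarrow> real^'n \<Rightarrow> real^'n"
  where "cov G X u v = cov_along G (\<lambda>x. x) X u v"

text \<open>\<open>R(x,y)z = \<nabla>\<^sub>x\<nabla>\<^sub>y z - \<nabla>\<^sub>y\<nabla>\<^sub>x z\<close>, evaluated with \<open>x\<close>, \<open>y\<close>, \<open>z\<close> extended to constant
  coefficient (hence commuting) vector fields.\<close>

definition curvature :: "'n::finite gram \<Rightarrow> real^'n \<Rightarrow> real^'n \<Rightarrow> real^'n \<Rightarrow> real^'n \<Rightarrow> real^'n"
  where "curvature G u x y z =
    cov G (\<lambda>u. cov G (\<lambda>_. z) u y) u x - cov G (\<lambda>u. cov G (\<lambda>_. z) u x) u y"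

text \<open>The cross product of an oriented three-dimensional Euclidean space with Gram matrix \<open>A\<close> in a
  positively oriented basis: \<open>ip A (wedge A v w) z\<close> is the volume form evaluated on \<open>v\<close>, \<open>w\<close>, \<open>z\<close>.\<close>

definition wedge :: "real^3^3 \<Rightarrow> real^3 \<Rightarrow> real^3 \<Rightarrow> real^3"
  where "wedge A v w = sqrt (det A) *\<^sub>R (matrix_inv A *v cross3 v w)"

section \<open>Riemannian manifolds\<close>

text \<open>A chart is a pair of a coordinate neighbourhood and a coordinate map, the latter being
  relevant only on the former.\<close>

type_synonym ('a, 'n) chart = "'a set \<times> ('a \<Rightarrow> real^'n)"

record ('a, 'n) riem =
  mtop :: "'a topology"
  atlas :: "('a, 'n) chart set"
  gram :: "('a, 'n) chart \<Rightarrow> 'n gram"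

abbreviation points :: "('a, 'n) riem \<Rightarrow> 'a set"
  where "points M \<equiv> topspace (mtop M)"

definition coords :: "('a, 'n) chart \<Rightarrow> (real^'n) set"
  where "coords c = snd c ` fst c"

text \<open>The expression of a map in charts of its source and target, and the coordinate domain on
  which it makes sense.  For the identity map this is the change of coordinates.\<close>

definition rep :: "('a, 'm) chart \<Rightarrow> ('b, 'n) chart \<Rightarrow> ('a \<Rightarrow> 'b) \<Rightarrow> real^'m \<Rightarrow> real^'n"
  where "rep c d f = snd d \<circ> f \<circ> inv_into (fst c) (snd c)"

definition rep_dom :: "('a, 'm) chart \<Rightarrow> ('b, 'n) chart \<Rightarrow> ('a \<Rightarrow> 'b) \<Rightarrow> (real^'m) set"
  where "rep_dom c d f = snd c ` (fst c \<inter> f -` fst d)"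

definition smooth_manifold :: "('a, 'n::finite) riem \<Rightarrow> bool" where
  "smooth_manifold M \<longleftrightarrow>
     Hausdorff_space (mtop M) \<and>
     (\<exists>\<B>. countable \<B> \<and> (\<forall>V\<in>\<B>. openin (mtop M) V) \<and>
        (\<forall>U x. openin (mtop M) U \<and> x \<in> U \<longrightarrow> (\<exists>V\<in>\<B>. x \<in> V \<and> V \<subseteq> U))) \<and>
     (\<forall>c\<in>atlas M. openin (mtop M) (fst c) \<and> open (coords c) \<and>
        homeomorphic_map (subtopology (mtop M) (fst c)) (top_of_set (coords c)) (snd c)) \<and>
     (\<Union>c\<in>atlas M. fst c) = points M \<and>
     (\<forall>c\<in>atlas M. \<forall>d\<in>atlas M. smooth_on (rep_dom c d (\<lambda>p. p)) (rep c d (\<lambda>p. p)))"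

definition riemannian_manifold :: "('a, 'n::finite) riem \<Rightarrow> bool" where
  "riemannian_manifold M \<longleftrightarrow>
     smooth_manifold M \<and>
     (\<forall>c\<in>atlas M. smooth_on (coords c) (gram M c) \<and>
        (\<forall>u\<in>coords c. transpose (gram M c u) = gram M c u \<and>
           (\<forall>v. v \<noteq> 0 \<longrightarrow> 0 < ip (gram M c u) v v))) \<and>
     (\<forall>c\<in>atlas M. \<forall>d\<in>atlas M. \<forall>u\<in>rep_dom c d (\<lambda>p. p). \<forall>v w.
        ip (gram M c u) v w =
        ip (gram M d (rep c d (\<lambda>p. p) u)) (Der (rep c d (\<lambda>p. p)) u v) (Der (rep c d (\<lambda>p. p)) u w))"

definition oriented :: "('a, 'n::finite) riem \<Rightarrow> bool" where
  "oriented M \<longleftrightarrow>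
     (\<forall>c\<in>atlas M. \<forall>d\<in>atlas M. \<forall>u\<in>rep_dom c d (\<lambda>p. p). 0 < det (matrix (Der (rep c d (\<lambda>p. p)) u)))"

definition simply_connected_space :: "'a topology \<Rightarrow> bool" where
  "simply_connected_space X \<longleftrightarrow>
     path_connected_space X \<and>
     (\<forall>g. pathin X g \<and> g 0 = g 1 \<longrightarrow>
        homotopic_with (\<lambda>r. r 0 = g 0 \<and> r 1 = g 0) (top_of_set {0..1::real}) X g (\<lambda>_. g 0))"

subsection \<open>Maps\<close>

definition smooth_map :: "('a, 'm::finite) riem \<Rightarrow> ('b, 'n::finite) riem \<Rightarrow> ('a \<Rightarrow> 'b) \<Rightarrow> bool" where
  "smooth_map M N f \<longleftrightarrow>
     continuous_map (mtop M) (mtop N) f \<and>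
     (\<forall>c\<in>atlas M. \<forall>d\<in>atlas N. smooth_on (rep_dom c d f) (rep c d f))"

definition isometric_immersion ::
    "('a, 'm::finite) riem \<Rightarrow> ('b, 'n::finite) riem \<Rightarrow> ('a \<Rightarrow> 'b) \<Rightarrow> bool" where
  "isometric_immersion M N f \<longleftrightarrow>
     smooth_map M N f \<and>
     (\<forall>c\<in>atlas M. \<forall>d\<in>atlas N. \<forall>u\<in>rep_dom c d f.
        inj (Der (rep c d f) u) \<and>
        (\<forall>v w. ip (gram M c u) v w =
           ip (gram N d (rep c d f u)) (Der (rep c d f) u v) (Der (rep c d f) u w)))"

text \<open>The inverse of an isometry is smooth by the inverse function theorem.\<close>

definition isometry :: "('a, 'n::finite) riem \<Rightarrow> ('a \<Rightarrow> 'a) \<Rightarrow> bool" where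
  "isometry M f \<longleftrightarrow> homeomorphic_map (mtop M) (mtop M) f \<and> isometric_immersion M M f"

definition homogeneous :: "('a, 'n::finite) riem \<Rightarrow> bool" where
  "homogeneous M \<longleftrightarrow> (\<forall>p\<in>points M. \<forall>q\<in>points M. \<exists>f. isometry M f \<and> f p = q)"

definition riemannian_submersion ::
    "('a, 'm::finite) riem \<Rightarrow> ('b, 'n::finite) riem \<Rightarrow> ('a \<Rightarrow> 'b) \<Rightarrow> bool" where
  "riemannian_submersion M B \<pi> \<longleftrightarrow>
     smooth_map M B \<pi> \<and> \<pi> ` points M = points B \<and>
     (\<forall>c\<in>atlas M. \<forall>d\<in>atlas B. \<forall>u\<in>rep_dom c d \<pi>.
        surj (Der (rep c d \<pi>) u) \<and>
        (let horizontal =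
           {v. \<forall>k. Der (rep c d \<pi>) u k = 0 \<longrightarrow> ip (gram M c u) v k = 0}
         in \<forall>v\<in>horizontal. \<forall>w\<in>horizontal.
           ip (gram B d (rep c d \<pi> u)) (Der (rep c d \<pi>) u v) (Der (rep c d \<pi>) u w) =
           ip (gram M c u) v w))"

subsection \<open>Vector fields\<close>

text \<open>A vector field is given by its components in every chart.\<close>

type_synonym ('a, 'n) vfield = "('a, 'n) chart \<Rightarrow> real^'n \<Rightarrow> real^'n"

definition vector_field :: "('a, 'n::finite) riem \<Rightarrow> ('a, 'n) vfield \<Rightarrow> bool" where
  "vector_field M X \<longleftrightarrow>
     (\<forall>c\<in>atlas M. smooth_on (coords c) (X c)) \<and>
     (\<forall>c\<in>atlas M. \<forall>d\<in>atlas M. \<forall>u\<in>rep_dom c d (\<lambda>p. p).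
        X d (rep c d (\<lambda>p. p) u) = Der (rep c d (\<lambda>p. p)) u (X c u))"

definition killing_field :: "('a, 'n::finite) riem \<Rightarrow> ('a, 'n) vfield \<Rightarrow> bool" where
  "killing_field M X \<longleftrightarrow>
     vector_field M X \<and>
     (\<forall>c\<in>atlas M. \<forall>u\<in>coords c. \<forall>v w.
        ip (gram M c u) (cov (gram M c) (X c) u v) w + ip (gram M c u) v (cov (gram M c) (X c) u w) = 0)"

text \<open>The Lie algebra of the isometry group consists of the complete Killing fields.  On a
  complete manifold, in particular on a homogeneous one, all Killing fields are complete, so there
  the following says that the isometry group has dimension four.  The existence and uniqueness
  of the coefficients say that the fields \<open>K i\<close> form a basis.\<close>

definition isometry_group_dim_4 :: "('a, 'n::finite) riem \<Rightarrow> bool" where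
  "isometry_group_dim_4 M \<longleftrightarrow>
     (\<exists>K :: 4 \<Rightarrow> ('a, 'n) vfield.
        (\<forall>i. killing_field M (K i)) \<and>
        (\<forall>X. killing_field M X \<longrightarrow>
           (\<exists>!a :: real^4. \<forall>c\<in>atlas M. \<forall>u\<in>coords c. X c u = (\<Sum>i\<in>UNIV. a $ i *\<^sub>R K i c u))))"

subsection \<open>Geodesics and curvature\<close>

definition geodesic :: "('a, 'n::finite) riem \<Rightarrow> (real \<Rightarrow> 'a) \<Rightarrow> bool" where
  "geodesic M \<gamma> \<longleftrightarrow>
     continuous_map euclideanreal (mtop M) \<gamma> \<and>
     (\<forall>c\<in>atlas M.
        let J = {t. \<gamma> t \<in> fst c}; q = snd c \<circ> \<gamma>; q' = (\<lambda>t. vector_derivative q (at t))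
        in smooth_on J q \<and>
           (\<forall>t\<in>J. vector_derivative q' (at t) + christoffel (gram M c) (q t) (q' t) (q' t) = 0))"

definition complete_manifold :: "('a, 'n::finite) riem \<Rightarrow> bool" where
  "complete_manifold M \<longleftrightarrow>
     (\<forall>c\<in>atlas M. \<forall>p\<in>fst c. \<forall>v.
        \<exists>\<gamma>. geodesic M \<gamma> \<and> \<gamma> 0 = p \<and> vector_derivative (snd c \<circ> \<gamma>) (at 0) = v)"

definition constant_curvature :: "('a, 'n::finite) riem \<Rightarrow> real \<Rightarrow> bool" where
  "constant_curvature M \<kappa> \<longleftrightarrow>
     (\<forall>c\<in>atlas M. \<forall>u\<in>coords c. \<forall>x y.
        ip (gram M c u) (curvature (gram M c) u x y y) x =
        \<kappa> * (ip (gram M c u) x x * ip (gram M c u) y y - (ip (gram M c u) x y)\<^sup>2))"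

section \<open>The homogeneous spaces\<close>

text \<open>The surface \<open>\<bbbM>\<^sup>2(\<kappa>)\<close>: sphere, Euclidean plane or hyperbolic plane.\<close>

definition space_form_surface :: "real \<Rightarrow> ('b, 2) riem \<Rightarrow> bool" where
  "space_form_surface \<kappa> B \<longleftrightarrow>
     riemannian_manifold B \<and> points B \<noteq> {} \<and> simply_connected_space (mtop B) \<and>
     complete_manifold B \<and> constant_curvature B \<kappa>"

text \<open>\<open>M\<close> is the total space \<open>\<bbbE>(\<kappa>,\<tau>)\<close>, with fibration \<open>\<pi>\<close> over \<open>B\<close> and unit vertical field \<open>\<xi>\<close>.
  The last conjunct is the definition of the bundle curvature \<open>\<tau>\<close>, with the cross product taken
  with respect to the orientation of the atlas.\<close>

definition E_space ::
    "real \<Rightarrow> real \<Rightarrow> ('a, 3) riem \<Rightarrow> ('b, 2) riem \<Rightarrow> ('a \<Rightarrow> 'b) \<Rightarrow> ('a, 3) vfield \<Rightarrow> bool" where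
  "E_space \<kappa> \<tau> M B \<pi> \<xi> \<longleftrightarrow>
     riemannian_manifold M \<and> oriented M \<and> points M \<noteq> {} \<and> simply_connected_space (mtop M) \<and>
     homogeneous M \<and> isometry_group_dim_4 M \<and>
     space_form_surface \<kappa> B \<and> riemannian_submersion M B \<pi> \<and>
     (\<forall>b\<in>points B. \<exists>\<gamma>. geodesic M \<gamma> \<and> range \<gamma> = {p \<in> points M. \<pi> p = b}) \<and>
     killing_field M \<xi> \<and>
     (\<forall>c\<in>atlas M. \<forall>u\<in>coords c. ip (gram M c u) (\<xi> c u) (\<xi> c u) = 1) \<and>
     (\<forall>c\<in>atlas M. \<forall>d\<in>atlas B. \<forall>u\<in>rep_dom c d \<pi>. Der (rep c d \<pi>) u (\<xi> c u) = 0) \<and>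
     (\<forall>c\<in>atlas M. \<forall>u\<in>coords c. \<forall>v.
        cov (gram M c) (\<xi> c) u v = \<tau> *\<^sub>R wedge (gram M c u) v (\<xi> c u))"

section \<open>Totally umbilic surfaces\<close>

text \<open>Below, \<open>F\<close> is the coordinate expression of an immersed surface.\<close>

definition unit_normal_field ::
    "3 gram \<Rightarrow> (real^2 \<Rightarrow> real^3) \<Rightarrow> (real^2) set \<Rightarrow> (real^2 \<Rightarrow> real^3) \<Rightarrow> bool" where
  "unit_normal_field G F W N \<longleftrightarrow>
     smooth_on W N \<and>
     (\<forall>u\<in>W. ip (G (F u)) (N u) (N u) = 1 \<and> (\<forall>v. ip (G (F u)) (N u) (Der F u v) = 0))"

text \<open>\<open>E\<close> is the shape operator \<open>v \<mapsto> - \<nabla>\<^sub>v N\<close> at \<open>u\<close>, as an endomorphism of the tangent plane of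
  the surface (which \<open>Der F u\<close> identifies with its image in the tangent space of the ambient
  manifold).  It is uniquely determined since \<open>Der F u\<close> is injective.\<close>

definition shape_operator ::
    "3 gram \<Rightarrow> (real^2 \<Rightarrow> real^3) \<Rightarrow> (real^2 \<Rightarrow> real^3) \<Rightarrow> real^2 \<Rightarrow> (real^2 \<Rightarrow> real^2) \<Rightarrow> bool" where
  "shape_operator G F N u E \<longleftrightarrow> linear E \<and> (\<forall>v. Der F u (E v) = - cov_along G F N u v)"

definition mean_curvature :: "(real^2 \<Rightarrow> real^2) \<Rightarrow> real"
  where "mean_curvature E = trace (matrix E) / 2"

text \<open>Unit normal fields exist near every point and are unique up to sign.  Changing the sign replaces
  \<open>E\<close> by \<open>- E\<close> and \<open>H\<close> by \<open>- H\<close>, so the condition \<open>E = H Id\<close> does not depend on which local unit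
  normal is used, and the surface need not be orientable.\<close>

definition totally_umbilic :: "('s, 2) riem \<Rightarrow> ('a, 3) riem \<Rightarrow> ('s \<Rightarrow> 'a) \<Rightarrow> bool" where
  "totally_umbilic S M f \<longleftrightarrow>
     (\<forall>p\<in>points S. \<exists>c\<in>atlas S. \<exists>d\<in>atlas M. \<exists>W N.
        p \<in> fst c \<and> snd c p \<in> W \<and> open W \<and> W \<subseteq> rep_dom c d f \<and>
        unit_normal_field (gram M d) (rep c d f) W N \<and>
        (\<forall>u\<in>W. \<exists>E. shape_operator (gram M d) (rep c d f) N u E \<and>
           E = (\<lambda>v. mean_curvature E *\<^sub>R v)))"

end

theory Submission
  imports Defs
begin

text \<open>Let \<open>F\<close> be an umbilic immersion with unit normal \<open>N\<close> and mean curvature \<open>h\<close>, and put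
  \<open>\<nu> = \<langle>N, \<xi>\<rangle>\<close> and \<open>n(v) = \<langle>dF(v), \<xi>\<rangle>\<close>.  Projecting to the base and using an orthonormal frame there,
  the symmetry of the second derivatives of \<open>N\<close> yields Codazzi's equation
  \<open>dh = - (\<kappa> - 4 \<tau>\<^sup>2) \<nu> n\<close> wherever \<open>\<nu> \<noteq> 0\<close>; hence \<open>d(\<nu> n) = 0\<close>.  On the other hand
  \<open>\<nabla>\<^sub>X \<xi> = \<tau> X \<and> \<xi>\<close> determines \<open>d\<nu>\<close> and \<open>dn\<close>, and gives \<open>d(\<nu> n) = \<plusminus> \<tau> (1 - 3 \<nu>\<^sup>2)\<close> times the area
  form.  So \<open>3 \<nu>\<^sup>2 = 1\<close> and \<open>d\<nu> = 0\<close>, which contradicts the formula for \<open>d\<nu>\<close> because \<open>\<tau> \<noteq> 0\<close>.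
  If \<open>\<nu>\<close> vanishes identically, the formula for \<open>d\<nu>\<close> makes the tangent vectors linearly dependent.\<close>

section \<open>Calculus of smooth maps\<close>

text \<open>The space is described by the curvature of its base and the equation for
  \<open>\<xi>\<close>; no curvature tensor of the total space is at hand from which Codazzi's
  equation could be read off. All data are therefore pulled back to the parameter domain of the
  surface and become ordinary functions there: components of the tangent vectors and of
  \<open>N\<close> along a frame of the base, together with the vertical components. Cartan's
  structure equations for these functions carry \<open>\<kappa>\<close> through the connection form
  of the frame and \<open>\<tau>\<close> through the exterior derivative of the form dual to
  \<open>\<xi>\<close>; what remains is polynomial algebra. Two obstacles shape the details. The
  frame has no prescribed orientation relative to the atlas, so \<open>\<tau>\<close> enters only up
  to sign, as a function whose square is known. And solving for the derivatives of \<open>h\<close>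
  requires the projection of the tangent plane to the base to be nondegenerate, which is ensured
  where \<open>\<nu>\<close> is nonzero.\<close>

lemma Der_eqI: "(f has_derivative f') (at u) \<Longrightarrow> Der f u = f'"
  by (metis frechet_derivative_at)

lemma has_derivative_Der: "f differentiable (at u) \<Longrightarrow> (f has_derivative Der f u) (at u)"
  by (simp add: frechet_derivative_works)

lemma Der_cong:
  assumes "open U" "u \<in> U" "\<And>x. x \<in> U \<Longrightarrow> f x = g x" "f differentiable (at u)"
  shows "Der f u = Der g u"
  using frechet_derivative_transform_within_open[OF assms(4,1,2)] assms(3) by blast

lemma differentiable_cong_open:
  assumes "open U" "u \<in> U" "\<And>x. x \<in> U \<Longrightarrow> f x = g x" "f differentiable (at u)"
  shows "g differentiable (at u)"
  using assms unfolding differentiable_def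
  by (metis has_derivative_transform_within_open)

section \<open>Differentiability classes under algebraic operations and composition\<close>

lemma Ck_on_cong:
  assumes "open U" "\<And>x. x \<in> U \<Longrightarrow> f x = g x" "Ck_on k U f"
  shows "Ck_on k U g"
  using assms(2,3)
proof (induction k arbitrary: f g)
  case 0
  then show ?case by (simp cong: continuous_on_cong)
next
  case (Suc k)
  show ?case
  proof (simp, intro conjI ballI allI)
    show "g differentiable (at u)" if "u \<in> U" for u
      using differentiable_cong_open[OF assms(1) that, of f g] Suc.prems that by auto
    show "Ck_on k U (\<lambda>u. Der g u v)" for v
    proof (rule Suc.IH)
      show "Ck_on k U (\<lambda>u. Der f u v)" using Suc.prems by simp
      show "Der f u v = Der g u v" if "u \<in> U" for u
        using Der_cong[OF assms(1) that, of f g] Suc.prems that by auto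
    qed
  qed
qed

lemma Ck_on_subset: "Ck_on k U f \<Longrightarrow> W \<subseteq> U \<Longrightarrow> Ck_on k W f"
  by (induction k arbitrary: f) (auto intro: continuous_on_subset)

lemma Ck_on_SucD: "Ck_on (Suc k) U f \<Longrightarrow> Ck_on k U f"
proof (induction k arbitrary: f)
  case 0
  then have "f differentiable_on U"
    by (simp add: differentiable_on_def differentiable_at_withinI)
  then show ?case by (simp add: differentiable_imp_continuous_on)
next
  case (Suc k)
  then have "\<forall>u\<in>U. f differentiable (at u)" "\<And>v. Ck_on (Suc k) U (\<lambda>u. Der f u v)"
    unfolding Ck_on.simps(2)[of "Suc k"] by blast+
  with Suc.IH show ?case by (simp only: Ck_on.simps(2)[of k]) blast
qed

lemma Ck_on_const: "Ck_on k U (\<lambda>_. c)"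
  by (induction k arbitrary: c) auto

lemma Ck_on_linear:
  assumes "bounded_linear h" "open U" "Ck_on k U f"
  shows "Ck_on k U (\<lambda>u. h (f u))"
  using assms(3)
proof (induction k arbitrary: f)
  case 0
  then show ?case using assms(1) by (auto intro: bounded_linear.continuous_on)
next
  case (Suc k)
  have d: "((\<lambda>u. h (f u)) has_derivative (\<lambda>v. h (Der f u v))) (at u)" if "u \<in> U" for u
    using Suc.prems that by (auto intro!: bounded_linear.has_derivative[OF assms(1)] has_derivative_Der)
  show ?case
  proof (simp, intro conjI ballI allI)
    show "(\<lambda>u. h (f u)) differentiable (at u)" if "u \<in> U" for u
      using d[OF that] differentiableI by blast
    show "Ck_on k U (\<lambda>u. Der (\<lambda>u. h (f u)) u v)" for v
      by (rule Ck_on_cong[OF assms(2), of "\<lambda>u. h (Der f u v)"])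
        (use Suc in \<open>auto simp: Der_eqI[OF d]\<close>)
  qed
qed

lemma Ck_on_add:
  assumes "open U" "Ck_on k U f" "Ck_on k U g"
  shows "Ck_on k U (\<lambda>u. f u + g u)"
  using assms(2,3)
proof (induction k arbitrary: f g)
  case 0
  then show ?case by (auto intro: continuous_on_add)
next
  case (Suc k)
  have d: "((\<lambda>u. f u + g u) has_derivative (\<lambda>v. Der f u v + Der g u v)) (at u)" if "u \<in> U" for u
    using Suc.prems that by (auto intro!: has_derivative_add has_derivative_Der)
  show ?case
  proof (simp, intro conjI ballI allI)
    show "(\<lambda>u. f u + g u) differentiable (at u)" if "u \<in> U" for u
      using d[OF that] differentiableI by blast
    show "Ck_on k U (\<lambda>u. Der (\<lambda>u. f u + g u) u v)" for v
      by (rule Ck_on_cong[OF assms(1), of "\<lambda>u. Der f u v + Der g u v"])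
        (use Suc in \<open>auto simp: Der_eqI[OF d]\<close>)
  qed
qed

lemma Ck_on_bilinear:
  assumes "bounded_bilinear m" "open U" "Ck_on k U f" "Ck_on k U g"
  shows "Ck_on k U (\<lambda>u. m (f u) (g u))"
  using assms(3,4)
proof (induction k arbitrary: f g)
  case 0
  then show ?case using assms(1) by (auto intro: bounded_bilinear.continuous_on)
next
  case (Suc k)
  have d: "((\<lambda>u. m (f u) (g u)) has_derivative (\<lambda>v. m (f u) (Der g u v) + m (Der f u v) (g u))) (at u)"
    if "u \<in> U" for u
    using Suc.prems that
    by (auto intro!: bounded_bilinear.FDERIV[OF assms(1)] has_derivative_Der)
  show ?case
  proof (simp, intro conjI ballI allI)
    show "(\<lambda>u. m (f u) (g u)) differentiable (at u)" if "u \<in> U" for u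
      using d[OF that] differentiableI by blast
    show "Ck_on k U (\<lambda>u. Der (\<lambda>u. m (f u) (g u)) u v)" for v
    proof (rule Ck_on_cong[OF assms(2), of "\<lambda>u. m (f u) (Der g u v) + m (Der f u v) (g u)"])
      show "Ck_on k U (\<lambda>u. m (f u) (Der g u v) + m (Der f u v) (g u))"
        using Suc.prems by (intro Ck_on_add[OF assms(2)] Suc.IH) (auto simp: Ck_on_SucD)
    qed (simp add: Der_eqI[OF d])
  qed
qed

lemma Ck_on_sum:
  assumes "open U" "\<And>i. i \<in> I \<Longrightarrow> Ck_on k U (f i)"
  shows "Ck_on k U (\<lambda>u. \<Sum>i\<in>I. f i u)"
  using assms(2)
  by (induction I rule: infinite_finite_induct) (auto intro!: Ck_on_const Ck_on_add assms(1))

lemma Ck_on_prod: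
  fixes f :: "'i \<Rightarrow> 'v::real_normed_vector \<Rightarrow> real"
  assumes "open U" "\<And>i. i \<in> I \<Longrightarrow> Ck_on k U (f i)"
  shows "Ck_on k U (\<lambda>u. \<Prod>i\<in>I. f i u)"
  using assms(2)
  by (induction I rule: infinite_finite_induct)
    (auto intro!: Ck_on_const Ck_on_bilinear[OF bounded_bilinear_mult] assms(1))

text \<open>In the chain rule the direction \<open>Der f u v\<close> moves with \<open>u\<close>,
  whereas \<open>Ck_on\<close> controls derivatives in fixed directions only. Expanding it in
  \<open>Basis\<close> restores fixed directions, at the price of coefficients that are again of
  class \<open>k\<close>; this is why the intermediate space is Euclidean.\<close>

lemma Ck_on_compose:
  fixes f :: "'v::real_normed_vector \<Rightarrow> 'w::euclidean_space"
  assumes "open U" "open W" "f ` W \<subseteq> U" "Ck_on k W f" "Ck_on k U g"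
  shows "Ck_on k W (\<lambda>u. g (f u))"
  using assms(4,5)
proof (induction k arbitrary: g)
  case 0
  then show ?case using assms(3) continuous_on_compose2 by auto
next
  case (Suc k)
  have d: "((\<lambda>u. g (f u)) has_derivative (\<lambda>v. Der g (f u) (Der f u v))) (at u)" if "u \<in> W" for u
    by (rule has_derivative_compose)
      (use Suc.prems that assms(3) in \<open>auto intro!: has_derivative_Der\<close>)
  have d': "Der (\<lambda>u. g (f u)) u v = (\<Sum>b\<in>Basis. (Der f u v \<bullet> b) *\<^sub>R Der g (f u) b)" if "u \<in> W" for u v
  proof -
    have lin: "linear (Der g (f u))"
      using Suc.prems that assms(3) by (auto intro!: linear_frechet_derivative)
    have "Der g (f u) (Der f u v) = Der g (f u) (\<Sum>b\<in>Basis. (Der f u v \<bullet> b) *\<^sub>R b)"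
      by (simp add: euclidean_representation)
    then show ?thesis
      using d[OF that] by (simp add: Der_eqI linear_sum[OF lin] linear_cmul[OF lin])
  qed
  show ?case
  proof (simp, intro conjI ballI allI)
    show "(\<lambda>u. g (f u)) differentiable (at u)" if "u \<in> W" for u
      using d[OF that] differentiableI by blast
    have f: "Ck_on k W f" using Suc.prems Ck_on_SucD by blast
    show "Ck_on k W (\<lambda>u. Der (\<lambda>u. g (f u)) u v)" for v
    proof (rule Ck_on_cong[OF assms(2), of "\<lambda>u. \<Sum>b\<in>Basis. (Der f u v \<bullet> b) *\<^sub>R Der g (f u) b"])
      show "Ck_on k W (\<lambda>u. \<Sum>b\<in>Basis. (Der f u v \<bullet> b) *\<^sub>R Der g (f u) b)"
        using Suc.prems f
        by (auto intro!: Ck_on_sum assms(2) Ck_on_bilinear[OF bounded_bilinear_scaleR]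
            Ck_on_linear[OF bounded_linear_inner_left] Suc.IH)
    qed (simp add: d')
  qed
qed

lemma Ck_on_inverse: "Ck_on k (- {0}) (inverse :: real \<Rightarrow> real)"
proof (induction k)
  case 0
  then show ?case by (auto intro!: continuous_intros)
next
  case (Suc k)
  have d: "(inverse has_derivative (\<lambda>v. - (inverse u * v * inverse u))) (at u)" if "u \<noteq> 0" for u :: real
    using has_derivative_inverse'[of u UNIV] that by simp
  show ?case
    unfolding Ck_on.simps
  proof (intro conjI ballI allI)
    show "inverse differentiable (at u)" if "u \<in> - {0}" for u :: real
      using d that differentiableI by (metis ComplD singletonI)
    show "Ck_on k (- {0}) (\<lambda>u. Der inverse u v)" for v :: real
    proof (rule Ck_on_cong)
      show "Ck_on k (- {0}) (\<lambda>u::real. (- v) * (inverse u * inverse u))"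
        by (intro Ck_on_bilinear[OF bounded_bilinear_mult] Ck_on_const Suc) auto
    qed (auto simp: Der_eqI[OF d])
  qed
qed

lemma Ck_on_sqrt: "Ck_on k {0<..} sqrt"
proof (induction k)
  case 0
  then show ?case by (auto intro!: continuous_intros)
next
  case (Suc k)
  have d: "(sqrt has_derivative (\<lambda>v. (v / 2) * inverse (sqrt u))) (at u)" if "u > 0" for u :: real
    using DERIV_real_sqrt[OF that] unfolding has_field_derivative_def
    by (elim has_derivative_eq_rhs) (simp add: fun_eq_iff)
  show ?case
    unfolding Ck_on.simps
  proof (intro conjI ballI allI)
    show "sqrt differentiable (at u)" if "u \<in> {0<..}" for u
      using d that differentiableI by auto
    show "Ck_on k {0<..} (\<lambda>u. Der sqrt u v)" for v
    proof (rule Ck_on_cong)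
      show "Ck_on k {0<..} (\<lambda>u. (v / 2) * inverse (sqrt u))"
        by (intro Ck_on_bilinear[OF bounded_bilinear_mult] Ck_on_const
            Ck_on_compose[OF _ _ _ Suc Ck_on_inverse]) auto
    qed (auto simp: Der_eqI[OF d])
  qed
qed

lemma smooth_on_cong: "open U \<Longrightarrow> (\<And>x. x \<in> U \<Longrightarrow> f x = g x) \<Longrightarrow> smooth_on U f \<Longrightarrow> smooth_on U g"
  unfolding smooth_on_def using Ck_on_cong by blast

lemma smooth_on_subset: "smooth_on U f \<Longrightarrow> W \<subseteq> U \<Longrightarrow> smooth_on W f"
  unfolding smooth_on_def using Ck_on_subset by blast

lemma smooth_on_differentiable: "smooth_on U f \<Longrightarrow> u \<in> U \<Longrightarrow> f differentiable (at u)"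
  using Ck_on.simps(2)[of 0 U f] by (simp add: smooth_on_def del: Ck_on.simps)

lemma smooth_on_has_derivative: "smooth_on U f \<Longrightarrow> u \<in> U \<Longrightarrow> (f has_derivative Der f u) (at u)"
  using smooth_on_differentiable has_derivative_Der by blast

lemma smooth_on_linear_Der: "smooth_on U f \<Longrightarrow> u \<in> U \<Longrightarrow> linear (Der f u)"
  using smooth_on_differentiable linear_frechet_derivative by blast

lemma smooth_on_continuous: "smooth_on U f \<Longrightarrow> continuous_on U f"
  using Ck_on.simps(1)[of U f] by (simp add: smooth_on_def del: Ck_on.simps)

lemma smooth_on_Der: "smooth_on U f \<Longrightarrow> smooth_on U (\<lambda>u. Der f u v)"
  unfolding smooth_on_def
proof
  show "Ck_on k U (\<lambda>u. Der f u v)" if "\<forall>k. Ck_on k U f" for k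
    using that[THEN spec, of "Suc k"] by simp
qed

lemma smooth_on_const: "smooth_on U (\<lambda>_. c)"
  by (simp add: smooth_on_def Ck_on_const)

lemma smooth_on_linear: "bounded_linear h \<Longrightarrow> open U \<Longrightarrow> smooth_on U f \<Longrightarrow> smooth_on U (\<lambda>u. h (f u))"
  by (simp add: smooth_on_def Ck_on_linear)

lemma smooth_on_add:
  "open U \<Longrightarrow> smooth_on U f \<Longrightarrow> smooth_on U g \<Longrightarrow> smooth_on U (\<lambda>u. f u + g u)"
  by (simp add: smooth_on_def Ck_on_add)

lemma smooth_on_minus: "open U \<Longrightarrow> smooth_on U f \<Longrightarrow> smooth_on U (\<lambda>u. - f u)"
  by (rule smooth_on_linear[OF bounded_linear_minus[OF bounded_linear_ident]])

lemma smooth_on_diff: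
  "open U \<Longrightarrow> smooth_on U f \<Longrightarrow> smooth_on U g \<Longrightarrow> smooth_on U (\<lambda>u. f u - g u)"
  using smooth_on_add[of U f "\<lambda>u. - g u"] smooth_on_minus by auto

lemma smooth_on_bilinear:
  "bounded_bilinear m \<Longrightarrow> open U \<Longrightarrow> smooth_on U f \<Longrightarrow> smooth_on U g \<Longrightarrow>
    smooth_on U (\<lambda>u. m (f u) (g u))"
  by (simp add: smooth_on_def Ck_on_bilinear)

lemmas smooth_on_mult = smooth_on_bilinear[OF bounded_bilinear_mult]
lemmas smooth_on_scaleR = smooth_on_bilinear[OF bounded_bilinear_scaleR]
lemmas smooth_on_inner = smooth_on_bilinear[OF bounded_bilinear_inner]

lemma smooth_on_sum:
  "open U \<Longrightarrow> (\<And>i. i \<in> I \<Longrightarrow> smooth_on U (f i)) \<Longrightarrow> smooth_on U (\<lambda>u. \<Sum>i\<in>I. f i u)"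
  by (simp add: smooth_on_def Ck_on_sum)

lemma smooth_on_prod:
  fixes f :: "'i \<Rightarrow> 'v::real_normed_vector \<Rightarrow> real"
  shows "open U \<Longrightarrow> (\<And>i. i \<in> I \<Longrightarrow> smooth_on U (f i)) \<Longrightarrow> smooth_on U (\<lambda>u. \<Prod>i\<in>I. f i u)"
  by (simp add: smooth_on_def Ck_on_prod)

lemma smooth_on_compose:
  fixes f :: "'v::real_normed_vector \<Rightarrow> 'w::euclidean_space"
  shows "open U \<Longrightarrow> open W \<Longrightarrow> f ` W \<subseteq> U \<Longrightarrow> smooth_on W f \<Longrightarrow> smooth_on U g \<Longrightarrow>
    smooth_on W (\<lambda>u. g (f u))"
  unfolding smooth_on_def using Ck_on_compose by blast

lemma smooth_on_inverse:
  "open U \<Longrightarrow> smooth_on U f \<Longrightarrow> (\<And>u. u \<in> U \<Longrightarrow> f u \<noteq> 0) \<Longrightarrow> smooth_on U (\<lambda>u. inverse (f u :: real))"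
  by (rule smooth_on_compose[of "- {0}"]) (auto simp: smooth_on_def Ck_on_inverse)

lemma smooth_on_divide:
  assumes "open U" "smooth_on U f" "smooth_on U g" "\<And>u. u \<in> U \<Longrightarrow> g u \<noteq> 0"
  shows "smooth_on U (\<lambda>u. f u / g u :: real)"
  unfolding divide_inverse by (intro smooth_on_mult smooth_on_inverse assms)

lemma smooth_on_sqrt:
  "open U \<Longrightarrow> smooth_on U f \<Longrightarrow> (\<And>u. u \<in> U \<Longrightarrow> f u > 0) \<Longrightarrow> smooth_on U (\<lambda>u. sqrt (f u))"
  by (rule smooth_on_compose[of "{0<..}"]) (auto simp: smooth_on_def Ck_on_sqrt)

lemma smooth_on_nth: "open U \<Longrightarrow> smooth_on U f \<Longrightarrow> smooth_on U (\<lambda>u. f u $ i)"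
  by (rule smooth_on_linear[OF bounded_linear_vec_nth])

lemma smooth_on_vec:
  fixes f :: "'n::finite \<Rightarrow> 'v::real_normed_vector \<Rightarrow> 'w::euclidean_space"
  assumes "open U" "\<And>i. smooth_on U (f i)"
  shows "smooth_on U (\<lambda>u. \<chi> i. f i u)"
proof -
  have "linear (axis i :: 'w \<Rightarrow> 'w^'n)" for i
    by (auto intro!: linearI simp: vec_eq_iff axis_def)
  then have *: "bounded_linear (axis i :: 'w \<Rightarrow> 'w^'n)" for i
    by (simp add: linear_conv_bounded_linear)
  have "(\<chi> i. f i u) = (\<Sum>i\<in>UNIV. axis i (f i u))" for u
    by (simp add: vec_eq_iff axis_def if_distrib cong: if_cong)
  then show ?thesis
    using assms by (auto intro!: smooth_on_sum smooth_on_linear[OF *])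
qed

lemma smooth_on_Der_along:
  fixes f :: "'v::real_normed_vector \<Rightarrow> 'w::euclidean_space"
  assumes "open U" "open W" "f ` W \<subseteq> U" "smooth_on W f" "smooth_on U g" "smooth_on W h"
  shows "smooth_on W (\<lambda>u. Der g (f u) (h u))"
proof (rule smooth_on_cong[OF assms(2), of "\<lambda>u. \<Sum>b\<in>Basis. (h u \<bullet> b) *\<^sub>R Der g (f u) b"])
  show "smooth_on W (\<lambda>u. \<Sum>b\<in>Basis. (h u \<bullet> b) *\<^sub>R Der g (f u) b)"
    by (intro smooth_on_sum smooth_on_scaleR smooth_on_inner smooth_on_const assms
        smooth_on_compose[OF assms(1) assms(2) assms(3) assms(4)] smooth_on_Der)
  fix u assume "u \<in> W"
  then have lin: "linear (Der g (f u))" using assms smooth_on_linear_Der by blast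
  have "Der g (f u) (h u) = Der g (f u) (\<Sum>b\<in>Basis. (h u \<bullet> b) *\<^sub>R b)"
    by (simp add: euclidean_representation)
  then show "(\<Sum>b\<in>Basis. (h u \<bullet> b) *\<^sub>R Der g (f u) b) = Der g (f u) (h u)"
    by (simp add: linear_sum[OF lin] linear_cmul[OF lin])
qed

lemma smooth_on_det:
  fixes A :: "'v::real_normed_vector \<Rightarrow> real^'n^'n"
  assumes "open U" "smooth_on U A"
  shows "smooth_on U (\<lambda>u. det (A u))"
  unfolding det_def
  by (intro smooth_on_sum smooth_on_mult smooth_on_const smooth_on_prod smooth_on_nth assms)

lemma matrix_inv_right:
  fixes A :: "real^'n^'n"
  assumes "invertible A"
  shows "A ** matrix_inv A = mat 1"
  using someI_ex[of "\<lambda>B. A ** B = mat 1 \<and> B ** A = mat 1"] assms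
  by (simp add: matrix_inv_def invertible_def)

lemma smooth_on_matrix_inv:
  fixes A :: "'v::real_normed_vector \<Rightarrow> real^'n^'n"
  assumes "open U" "smooth_on U A" "\<And>u. u \<in> U \<Longrightarrow> invertible (A u)"
  shows "smooth_on U (\<lambda>u. matrix_inv (A u))"
proof (rule smooth_on_cong[OF assms(1)])
  \<comment> \<open>Cramer's rule: column \<open>k\<close> of the matrix is replaced by the unit
    vector with index \<open>l\<close>. In this form smoothness follows from that of
    determinants.\<close>
  define B where "B u = (\<chi> k l. det (\<chi> i j. if j = k then (axis l 1 :: real^'n) $ i else A u $ i $ j) / det (A u))" for u
  have *: "smooth_on U (\<lambda>u. if j = k then axis l 1 $ i else A u $ i $ j)" for i j k and l :: 'n
    by (cases "j = k") (auto intro!: smooth_on_const smooth_on_nth assms)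
  show "smooth_on U B"
    unfolding B_def
    by (intro smooth_on_vec smooth_on_divide smooth_on_det assms *)
      (use assms(3) invertible_det_nz in blast)
  fix u assume "u \<in> U"
  then have inv: "invertible (A u)" by (rule assms(3))
  have "matrix_inv (A u) $ k $ l = B u $ k $ l" for k l
  proof -
    have "A u *v (matrix_inv (A u) *v axis l 1) = axis l 1"
      by (simp add: matrix_vector_mul_assoc matrix_inv_right[OF inv])
    then have "matrix_inv (A u) *v axis l 1 =
        (\<chi> k. det (\<chi> i j. if j = k then (axis l 1 :: real^'n) $ i else A u $ i $ j) / det (A u))"
      using cramer[of "A u"] inv invertible_det_nz by blast
    then have "(matrix_inv (A u) *v axis l 1) $ k = B u $ k $ l"
      by (simp add: B_def)
    then show ?thesis
      by (simp add: matrix_vector_mult_basis column_def)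
  qed
  then show "B u = matrix_inv (A u)" by (simp add: vec_eq_iff)
qed

section \<open>Symmetry of second derivatives\<close>

lemma second_difference_mean_value:
  fixes f :: "'v::real_normed_vector \<Rightarrow> real"
  assumes sm: "smooth_on U f" and h: "h > 0"
    and sub: "\<And>s t. 0 \<le> s \<Longrightarrow> s \<le> h \<Longrightarrow> 0 \<le> t \<Longrightarrow> t \<le> h \<Longrightarrow> u + s *\<^sub>R v + t *\<^sub>R w \<in> U"
  obtains s t where "0 < s" "s < h" "0 < t" "t < h"
    "f (u + h *\<^sub>R v + h *\<^sub>R w) - f (u + h *\<^sub>R v) - f (u + h *\<^sub>R w) + f u =
      h * h * Der (\<lambda>x. Der f x v) (u + s *\<^sub>R v + t *\<^sub>R w) w"
proof -
  \<comment> \<open>The second difference is the increment of \<open>\<phi>\<close> from 0 to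
    \<open>h\<close>. The mean value theorem is applied to \<open>\<phi>\<close>, and then in the
    direction \<open>w\<close> to the derivative of \<open>f\<close> along \<open>v\<close>.\<close>
  define \<phi> where "\<phi> s = f (u + s *\<^sub>R v + h *\<^sub>R w) - f (u + s *\<^sub>R v)" for s
  have der: "((\<lambda>s. g (a + s *\<^sub>R b)) has_real_derivative Der g (a + s *\<^sub>R b) b) (at s)"
    if "g differentiable (at (a + s *\<^sub>R b))" for g :: "'v \<Rightarrow> real" and a b s
  proof -
    have "((\<lambda>s. g (a + s *\<^sub>R b)) has_derivative (\<lambda>x. Der g (a + s *\<^sub>R b) (x *\<^sub>R b))) (at s)"
      by (rule has_derivative_compose[where g = g and f = "\<lambda>s. a + s *\<^sub>R b", OF _ has_derivative_Der[OF that]])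
        (auto intro!: derivative_eq_intros)
    moreover have "Der g (a + s *\<^sub>R b) (x *\<^sub>R b) = Der g (a + s *\<^sub>R b) b * x" for x
      using linear_cmul[OF linear_frechet_derivative[OF that]] by simp
    ultimately show ?thesis by (simp add: has_field_derivative_def)
  qed
  have df: "f differentiable (at x)" if "x \<in> U" for x
    using smooth_on_differentiable[OF sm that] .
  have "(\<phi> has_real_derivative (Der f (u + s *\<^sub>R v + h *\<^sub>R w) v - Der f (u + s *\<^sub>R v) v)) (at s)"
    if "0 \<le> s" "s \<le> h" for s
  proof -
    have "f differentiable (at ((u + h *\<^sub>R w) + s *\<^sub>R v))" "f differentiable (at (u + s *\<^sub>R v))"
      using df[OF sub[of s h]] df[OF sub[of s 0]] h that by (simp_all add: algebra_simps)
    from DERIV_diff[OF der[OF this(1)] der[OF this(2)]] show ?thesis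
      by (simp add: \<phi>_def[abs_def] algebra_simps)
  qed
  from MVT2[OF h this] obtain s where s: "0 < s" "s < h"
    "\<phi> h - \<phi> 0 = h * (Der f (u + s *\<^sub>R v + h *\<^sub>R w) v - Der f (u + s *\<^sub>R v) v)" by auto
  have "((\<lambda>t. Der f (u + s *\<^sub>R v + t *\<^sub>R w) v) has_real_derivative
      Der (\<lambda>x. Der f x v) (u + s *\<^sub>R v + t *\<^sub>R w) w) (at t)" if "0 \<le> t" "t \<le> h" for t
    by (rule der, rule smooth_on_differentiable[OF smooth_on_Der[OF sm] sub]) (use s that in auto)
  from MVT2[OF h this] obtain t where "0 < t" "t < h"
    "Der f (u + s *\<^sub>R v + h *\<^sub>R w) v - Der f (u + s *\<^sub>R v) v =
       h * Der (\<lambda>x. Der f x v) (u + s *\<^sub>R v + t *\<^sub>R w) w" by auto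
  with s show thesis
    by (intro that[of s t]) (auto simp: \<phi>_def algebra_simps)
qed

lemma Der_commute_real:
  fixes f :: "'v::real_normed_vector \<Rightarrow> real"
  assumes "open U" "u \<in> U" and sm: "smooth_on U f"
  shows "Der (\<lambda>x. Der f x v) u w = Der (\<lambda>x. Der f x w) u v"
proof -
  let ?A = "\<lambda>v w x. Der (\<lambda>x. Der f x v) x w"
  have cont: "isCont (?A v w) u" for v w
    using smooth_on_continuous[OF smooth_on_Der[OF smooth_on_Der[OF sm]]] assms
    by (simp add: continuous_on_eq_continuous_at)
  have "\<bar>?A v w u - ?A w v u\<bar> < e" if "e > 0" for e :: real
  proof -
    have e2: "e / 2 > 0" using that by simp
    obtain d1 where d1: "d1 > 0" "\<And>x. dist x u < d1 \<Longrightarrow> \<bar>?A v w x - ?A v w u\<bar> < e / 2"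
      using cont[of v w] e2 unfolding continuous_at_eps_delta dist_real_def by meson
    obtain d2 where d2: "d2 > 0" "\<And>x. dist x u < d2 \<Longrightarrow> \<bar>?A w v x - ?A w v u\<bar> < e / 2"
      using cont[of w v] e2 unfolding continuous_at_eps_delta dist_real_def by meson
    obtain d3 where d3: "d3 > 0" "\<And>x. dist x u < d3 \<Longrightarrow> x \<in> U"
      using assms(1,2) unfolding open_dist by meson
    define d where "d = min d1 (min d2 d3)"
    \<comment> \<open>This keeps the parallelogram with sides \<open>h\<close> times
      \<open>v\<close> and \<open>h\<close> times \<open>w\<close> in the ball of radius
      \<open>d\<close>. The added 1 makes the estimate strict and covers the case of two zero
      vectors.\<close>
    define h where "h = d / (norm v + norm w + 1)"
    have d: "d > 0" using d1 d2 d3 by (simp add: d_def)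
    have nz: "norm v + norm w + 1 > 0" by (smt (verit) norm_ge_zero)
    have h: "h > 0" using d nz by (simp add: h_def)
    have near: "dist (u + s *\<^sub>R v + t *\<^sub>R w) u < d" if "0 \<le> s" "s \<le> h" "0 \<le> t" "t \<le> h" for s t
    proof -
      have "dist (u + s *\<^sub>R v + t *\<^sub>R w) u = norm (s *\<^sub>R v + t *\<^sub>R w)"
        by (simp add: dist_norm algebra_simps)
      also have "\<dots> \<le> s * norm v + t * norm w"
        using norm_triangle_ineq[of "s *\<^sub>R v" "t *\<^sub>R w"] that by simp
      also have "\<dots> \<le> h * norm v + h * norm w"
        using that by (intro add_mono mult_right_mono) auto
      also have "\<dots> < h * (norm v + norm w + 1)" using h by (simp add: algebra_simps)
      also have "\<dots> = d" using nz by (simp add: h_def)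
      finally show ?thesis .
    qed
    have near': "dist (u + s *\<^sub>R w + t *\<^sub>R v) u < d" if "0 \<le> s" "s \<le> h" "0 \<le> t" "t \<le> h" for s t
      using near[of t s] that by (simp add: algebra_simps)
    obtain s t where 1: "0 < s" "s < h" "0 < t" "t < h"
      "f (u + h *\<^sub>R v + h *\<^sub>R w) - f (u + h *\<^sub>R v) - f (u + h *\<^sub>R w) + f u =
       h * h * ?A v w (u + s *\<^sub>R v + t *\<^sub>R w)"
      by (rule second_difference_mean_value[OF sm h, of u v w])
        (use near d3 d_def in auto)
    obtain s' t' where 2: "0 < s'" "s' < h" "0 < t'" "t' < h"
      "f (u + h *\<^sub>R w + h *\<^sub>R v) - f (u + h *\<^sub>R w) - f (u + h *\<^sub>R v) + f u =
       h * h * ?A w v (u + s' *\<^sub>R w + t' *\<^sub>R v)"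
      by (rule second_difference_mean_value[OF sm h, of u w v])
        (use near' d3 d_def in auto)
    \<comment> \<open>The second difference is symmetric in \<open>v\<close> and \<open>w\<close>,
      so the two mixed derivatives coincide when taken at two points near \<open>u\<close>;
      continuity moves both points to \<open>u\<close>.\<close>
    have "h * h * ?A v w (u + s *\<^sub>R v + t *\<^sub>R w) = h * h * ?A w v (u + s' *\<^sub>R w + t' *\<^sub>R v)"
      using 1(5) 2(5) by (simp add: algebra_simps)
    then have "?A v w (u + s *\<^sub>R v + t *\<^sub>R w) = ?A w v (u + s' *\<^sub>R w + t' *\<^sub>R v)"
      using h by simp
    moreover have "\<bar>?A v w (u + s *\<^sub>R v + t *\<^sub>R w) - ?A v w u\<bar> < e / 2"
      using near[of s t] 1 by (intro d1(2)) (auto simp: d_def)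
    moreover have "\<bar>?A w v (u + s' *\<^sub>R w + t' *\<^sub>R v) - ?A w v u\<bar> < e / 2"
      using near'[of s' t'] 2 by (intro d2(2)) (auto simp: d_def)
    ultimately show ?thesis by linarith
  qed
  then show ?thesis by (metis abs_le_zero_iff eq_iff_diff_eq_0 linorder_not_less order_less_irrefl)
qed

lemma Der_commute:
  fixes f :: "'v::real_normed_vector \<Rightarrow> 'w::euclidean_space"
  assumes "open U" "u \<in> U" and sm: "smooth_on U f"
  shows "Der (\<lambda>x. Der f x v) u w = Der (\<lambda>x. Der f x w) u v"
proof (rule euclidean_eqI)
  fix b :: 'w
  have 1: "Der (\<lambda>x. g x \<bullet> b) u w = Der g u w \<bullet> b" if "g differentiable (at u)" for g :: "'v \<Rightarrow> 'w" and w u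
    by (rule fun_cong[OF Der_eqI])
      (rule bounded_linear.has_derivative[OF bounded_linear_inner_left has_derivative_Der[OF that]])
  have 2: "Der (\<lambda>x. Der (\<lambda>x. f x \<bullet> b) x v) u w = Der (\<lambda>x. Der f x v) u w \<bullet> b" for v w
  proof -
    have "Der (\<lambda>x. Der f x v \<bullet> b) u = Der (\<lambda>x. Der (\<lambda>x. f x \<bullet> b) x v) u"
    proof (rule Der_cong[OF assms(1,2)])
      show "Der f x v \<bullet> b = Der (\<lambda>x. f x \<bullet> b) x v" if "x \<in> U" for x
        using 1 smooth_on_differentiable[OF sm that] by simp
      show "(\<lambda>x. Der f x v \<bullet> b) differentiable (at u)"
        using assms by (intro smooth_on_differentiable[of U] smooth_on_inner smooth_on_const smooth_on_Der)
    qed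
    then show ?thesis
      using 1[OF smooth_on_differentiable[OF smooth_on_Der[OF sm] assms(2)], of v w] by simp
  qed
  have "smooth_on U (\<lambda>x. f x \<bullet> b)" using assms by (intro smooth_on_inner smooth_on_const)
  from Der_commute_real[OF assms(1,2) this]
  show "Der (\<lambda>x. Der f x v) u w \<bullet> b = Der (\<lambda>x. Der f x w) u v \<bullet> b"
    by (simp add: 2)
qed

section \<open>Chain rules along a map\<close>

lemma Der_compose:
  assumes "f differentiable (at u)" "g differentiable (at (f u))"
  shows "Der (\<lambda>x. g (f x)) u v = Der g (f u) (Der f u v)"
  by (rule fun_cong[OF Der_eqI])
    (rule has_derivative_compose[OF has_derivative_Der[OF assms(1)] has_derivative_Der[OF assms(2)]])

lemma Der_Der_along:
  fixes f :: "'v::real_normed_vector \<Rightarrow> 'w::euclidean_space"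
  assumes "smooth_on U p" "f u \<in> U" "open U" "f differentiable (at u)" "X differentiable (at u)"
  shows "Der (\<lambda>u. Der p (f u) (X u)) u v =
    Der (\<lambda>y. Der p y (X u)) (f u) (Der f u v) + Der p (f u) (Der X u v)"
proof -
  have expand: "Der p y z = (\<Sum>b\<in>Basis. (z \<bullet> b) *\<^sub>R Der p y b)" if "y \<in> U" for y z
  proof -
    have lin: "linear (Der p y)" using smooth_on_linear_Der[OF assms(1) that] .
    have "Der p y z = Der p y (\<Sum>b\<in>Basis. (z \<bullet> b) *\<^sub>R b)"
      by (simp add: euclidean_representation)
    then show ?thesis by (simp add: linear_sum[OF lin] linear_cmul[OF lin])
  qed
  have "isCont f u" using assms(4) differentiable_imp_continuous_within by blast
  then have ev: "eventually (\<lambda>x. f x \<in> U) (at u)"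
    using assms(2,3) by (simp add: continuous_at topological_tendstoD)
  have db: "((\<lambda>y. Der p y b) has_derivative Der (\<lambda>y. Der p y b) (f u)) (at (f u))" for b
    by (rule smooth_on_has_derivative[OF smooth_on_Der[OF assms(1)] assms(2)])
  have df: "((\<lambda>u. Der p (f u) b) has_derivative (\<lambda>v. Der (\<lambda>y. Der p y b) (f u) (Der f u v))) (at u)" for b
    by (rule has_derivative_compose[OF has_derivative_Der[OF assms(4)] db])
  have dX: "((\<lambda>u. X u \<bullet> b) has_derivative (\<lambda>v. Der X u v \<bullet> b)) (at u)" for b
    by (rule bounded_linear.has_derivative[OF bounded_linear_inner_left has_derivative_Der[OF assms(5)]])
  have "((\<lambda>u. \<Sum>b\<in>Basis. (X u \<bullet> b) *\<^sub>R Der p (f u) b) has_derivative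
     (\<lambda>v. \<Sum>b\<in>Basis. (X u \<bullet> b) *\<^sub>R Der (\<lambda>y. Der p y b) (f u) (Der f u v)
        + (Der X u v \<bullet> b) *\<^sub>R Der p (f u) b)) (at u)"
    by (intro has_derivative_sum has_derivative_scaleR df dX)
  then have 1: "((\<lambda>u. Der p (f u) (X u)) has_derivative
     (\<lambda>v. \<Sum>b\<in>Basis. (X u \<bullet> b) *\<^sub>R Der (\<lambda>y. Der p y b) (f u) (Der f u v)
        + (Der X u v \<bullet> b) *\<^sub>R Der p (f u) b)) (at u)"
    by (rule has_derivative_transform_eventually)
      (use ev in \<open>auto elim: eventually_mono simp: expand[symmetric] assms(2)\<close>)
  have "((\<lambda>y. \<Sum>b\<in>Basis. (X u \<bullet> b) *\<^sub>R Der p y b) has_derivative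
     (\<lambda>v. \<Sum>b\<in>Basis. (X u \<bullet> b) *\<^sub>R Der (\<lambda>y. Der p y b) (f u) v)) (at (f u))"
    by (intro has_derivative_sum has_derivative_scaleR_right db)
  then have 2: "((\<lambda>y. Der p y (X u)) has_derivative
     (\<lambda>v. \<Sum>b\<in>Basis. (X u \<bullet> b) *\<^sub>R Der (\<lambda>y. Der p y b) (f u) v)) (at (f u))"
    by (rule has_derivative_transform_within_open[OF _ assms(3,2)]) (simp add: expand)
  show ?thesis
    by (simp add: Der_eqI[OF 1] Der_eqI[OF 2] expand[OF assms(2), of "Der X u v"] sum.distrib)
qed

section \<open>Metrics and covariant derivatives in coordinates\<close>

lemma bounded_bilinear_matrix_vector_mult:
  "bounded_bilinear ((*v) :: real^'n^'m \<Rightarrow> real^'n \<Rightarrow> real^'m)"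
  by (simp add: bilinear_conv_bounded_bilinear[symmetric] bilinear_def linear_iff
      vec_eq_iff matrix_vector_mult_def algebra_simps sum.distrib sum_distrib_left)

lemma ip_add_left: "ip A (v + w) z = ip A v z + ip A w z"
  and ip_add_right: "ip A v (w + z) = ip A v w + ip A v z"
  and ip_scaleR_left: "ip A (c *\<^sub>R v) w = c * ip A v w"
  and ip_scaleR_right: "ip A v (c *\<^sub>R w) = c * ip A v w"
  and ip_diff_left: "ip A (v - w) z = ip A v z - ip A w z"
  and ip_diff_right: "ip A v (w - z) = ip A v w - ip A v z"
  and ip_minus_left: "ip A (- v) w = - ip A v w"
  and ip_minus_right: "ip A v (- w) = - ip A v w"
  and ip_zero_left: "ip A 0 w = 0"
  and ip_zero_right: "ip A v 0 = 0"
  unfolding ip_def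
  by (simp_all add: inner_add_left inner_add_right inner_diff_left inner_diff_right
      matrix_vector_right_distrib matrix_vector_mult_diff_distrib
      bounded_bilinear.scaleR_right[OF bounded_bilinear_matrix_vector_mult]
      bounded_bilinear.minus_right[OF bounded_bilinear_matrix_vector_mult])

lemmas ip_simps = ip_add_left ip_add_right ip_scaleR_left ip_scaleR_right ip_diff_left
  ip_diff_right ip_minus_left ip_minus_right ip_zero_left ip_zero_right

lemma ip_sum_expand: "ip A v w = (\<Sum>i\<in>UNIV. \<Sum>j\<in>UNIV. v $ i * w $ j * A $ i $ j)"
  by (simp add: ip_def inner_vec_def matrix_vector_mult_def sum_distrib_left mult_ac)

lemma ip_commute: "transpose A = A \<Longrightarrow> ip A v w = ip A w v"
  unfolding ip_def by (metis dot_lmul_matrix inner_commute vector_transpose_matrix)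

lemma ip_has_derivative:
  assumes "(A has_derivative A') (at u)" "(X has_derivative X') (at u)" "(Y has_derivative Y') (at u)"
  shows "((\<lambda>u. ip (A u) (X u) (Y u)) has_derivative
    (\<lambda>v. ip (A' v) (X u) (Y u) + ip (A u) (X' v) (Y u) + ip (A u) (X u) (Y' v))) (at u)"
  unfolding ip_def
  by (rule has_derivative_eq_rhs,
      rule has_derivative_inner[OF assms(2)
        bounded_bilinear.FDERIV[OF bounded_bilinear_matrix_vector_mult assms(1) assms(3)]])
    (simp add: fun_eq_iff inner_add_right)

lemma smooth_on_ip:
  assumes "open U" "smooth_on U A" "smooth_on U X" "smooth_on U Y"
  shows "smooth_on U (\<lambda>u. ip (A u) (X u) (Y u))"
  unfolding ip_def
  by (intro smooth_on_inner smooth_on_bilinear[OF bounded_bilinear_matrix_vector_mult] assms)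

section \<open>The Levi-Civita connection of a metric on an open set\<close>

locale coordinate_metric =
  fixes G :: "'n::finite gram" and U :: "(real^'n) set"
  assumes open_dom: "open U"
    and smooth_gram: "smooth_on U G"
    and gram_sym: "u \<in> U \<Longrightarrow> transpose (G u) = G u"
    and gram_pos: "u \<in> U \<Longrightarrow> v \<noteq> 0 \<Longrightarrow> 0 < ip (G u) v v"
begin

lemma gram_commute: "u \<in> U \<Longrightarrow> ip (G u) v w = ip (G u) w v"
  by (rule ip_commute[OF gram_sym])

lemma gram_eqI:
  assumes "u \<in> U" "\<And>z. ip (G u) x z = ip (G u) y z"
  shows "x = y"
proof (rule ccontr)
  assume "x \<noteq> y"
  then have "0 < ip (G u) (x - y) (x - y)" using gram_pos[OF assms(1)] by simp
  then show False using assms(2)[of "x - y"] by (simp add: ip_simps)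
qed

lemma gram_invertible: "u \<in> U \<Longrightarrow> invertible (G u)"
proof -
  assume u: "u \<in> U"
  have "x = 0" if "G u *v x = 0" for x
    using gram_pos[OF u, of x] that by (auto simp: ip_def)
  then show ?thesis
    by (simp add: invertible_left_inverse matrix_left_invertible_ker)
qed

lemma gram_deriv_commute:
  assumes "u \<in> U"
  shows "ip (Der G u z) v w = ip (Der G u z) w v"
proof (rule ip_commute)
  have lin: "bounded_linear (transpose :: real^'n^'n \<Rightarrow> real^'n^'n)"
    unfolding linear_conv_bounded_linear[symmetric]
    by (auto intro!: linearI simp: transpose_def vec_eq_iff)
  have d: "(G has_derivative Der G u) (at u)"
    by (rule smooth_on_has_derivative[OF smooth_gram assms])
  have "Der (\<lambda>x. transpose (G x)) u = Der G u"
  proof (rule Der_cong[OF open_dom assms gram_sym])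
    show "(\<lambda>x. transpose (G x)) differentiable (at u)"
      using bounded_linear.has_derivative[OF lin d] differentiableI by blast
  qed
  then show "transpose (Der G u z) = Der G u z"
    using Der_eqI[OF bounded_linear.has_derivative[OF lin d]] by metis
qed

lemma gram_deriv_expand:
  assumes "u \<in> U"
  shows "ip (Der G u z) v w =
    (\<Sum>k\<in>UNIV. \<Sum>i\<in>UNIV. \<Sum>j\<in>UNIV. z $ k * v $ i * w $ j * Der G u (axis k 1) $ i $ j)"
proof -
  have lin: "linear (Der G u)" by (rule smooth_on_linear_Der[OF smooth_gram assms])
  have "Der G u z = Der G u (\<Sum>k\<in>UNIV. z $ k *\<^sub>R axis k 1)"
    by (metis basis_expansion scalar_mult_eq_scaleR)
  also have "\<dots> = (\<Sum>k\<in>UNIV. z $ k *\<^sub>R Der G u (axis k 1))"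
    by (simp add: linear_sum[OF lin] linear_cmul[OF lin])
  finally have "ip (Der G u z) v w =
      (\<Sum>i\<in>UNIV. \<Sum>j\<in>UNIV. \<Sum>k\<in>UNIV. v $ i * w $ j * (z $ k * Der G u (axis k 1) $ i $ j))"
    by (simp add: ip_sum_expand sum_distrib_left)
  also have "\<dots> = (\<Sum>i\<in>UNIV. \<Sum>k\<in>UNIV. \<Sum>j\<in>UNIV. v $ i * w $ j * (z $ k * Der G u (axis k 1) $ i $ j))"
    by (intro sum.cong refl sum.swap)
  also have "\<dots> = (\<Sum>k\<in>UNIV. \<Sum>i\<in>UNIV. \<Sum>j\<in>UNIV. v $ i * w $ j * (z $ k * Der G u (axis k 1) $ i $ j))"
    by (rule sum.swap)
  finally show ?thesis by (simp add: mult_ac)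
qed

text \<open>Pairing with \<open>G u\<close> cancels the inverse matrix in the symbols. What remains
  is the Koszul formula for constant fields, which yields both the symmetry of the symbols and
  metric compatibility.\<close>

lemma christoffel_first_kind:
  assumes u: "u \<in> U"
  shows "2 * ip (G u) (christoffel G u v w) z =
    ip (Der G u v) w z + ip (Der G u w) v z - ip (Der G u z) v w"
proof -
  define c where "c i j l = (Der G u (axis i 1) $ j $ l + Der G u (axis j 1) $ i $ l
    - Der G u (axis l 1) $ i $ j)" for i j l
  define L where "L = (\<chi> l. \<Sum>i\<in>UNIV. \<Sum>j\<in>UNIV. c i j l * v $ i * w $ j / 2)"
  have "christoffel G u v w = matrix_inv (G u) *v L"
  proof -
    have "(\<Sum>i\<in>UNIV. \<Sum>j\<in>UNIV. (\<Sum>l\<in>UNIV. matrix_inv (G u) $ k $ l * c i j l) / 2 * v $ i * w $ j) =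
      (\<Sum>l\<in>UNIV. matrix_inv (G u) $ k $ l * (\<Sum>i\<in>UNIV. \<Sum>j\<in>UNIV. c i j l * v $ i * w $ j / 2))"
      (is "?l = ?r") for k
    proof -
      have "?l = (\<Sum>i\<in>UNIV. \<Sum>j\<in>UNIV. \<Sum>l\<in>UNIV. matrix_inv (G u) $ k $ l * (c i j l * v $ i * w $ j / 2))"
        by (simp add: sum_distrib_left sum_distrib_right sum_divide_distrib mult_ac)
      also have "\<dots> = (\<Sum>i\<in>UNIV. \<Sum>l\<in>UNIV. \<Sum>j\<in>UNIV. matrix_inv (G u) $ k $ l * (c i j l * v $ i * w $ j / 2))"
        by (intro sum.cong refl sum.swap)
      also have "\<dots> = (\<Sum>l\<in>UNIV. \<Sum>i\<in>UNIV. \<Sum>j\<in>UNIV. matrix_inv (G u) $ k $ l * (c i j l * v $ i * w $ j / 2))"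
        by (rule sum.swap)
      finally show ?thesis by (simp add: sum_distrib_left)
    qed
    then show ?thesis
      by (simp add: christoffel_def christoffel_symbol_def matrix_vector_mult_def L_def c_def vec_eq_iff)
  qed
  then have "G u *v christoffel G u v w = L"
    by (simp add: matrix_vector_mul_assoc matrix_inv_right[OF gram_invertible[OF u]])
  then have "ip (G u) (christoffel G u v w) z = z \<bullet> L"
    unfolding gram_commute[OF u, of _ z] by (simp add: ip_def)
  then have "2 * ip (G u) (christoffel G u v w) z =
    (\<Sum>l\<in>UNIV. \<Sum>i\<in>UNIV. \<Sum>j\<in>UNIV. z $ l * v $ i * w $ j * c i j l)"
    by (simp add: L_def inner_vec_def sum_distrib_left mult_ac)
  also have "\<dots> = (\<Sum>l\<in>UNIV. \<Sum>i\<in>UNIV. \<Sum>j\<in>UNIV. v $ i * w $ j * z $ l * Der G u (axis i 1) $ j $ l)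
    + (\<Sum>l\<in>UNIV. \<Sum>i\<in>UNIV. \<Sum>j\<in>UNIV. w $ j * v $ i * z $ l * Der G u (axis j 1) $ i $ l)
    - (\<Sum>l\<in>UNIV. \<Sum>i\<in>UNIV. \<Sum>j\<in>UNIV. z $ l * v $ i * w $ j * Der G u (axis l 1) $ i $ j)"
    by (simp add: c_def algebra_simps sum.distrib sum_subtractf)
  also have "(\<Sum>l\<in>UNIV. \<Sum>i\<in>UNIV. \<Sum>j\<in>UNIV. v $ i * w $ j * z $ l * Der G u (axis i 1) $ j $ l) =
    (\<Sum>i\<in>UNIV. \<Sum>l\<in>UNIV. \<Sum>j\<in>UNIV. v $ i * w $ j * z $ l * Der G u (axis i 1) $ j $ l)"
    by (rule sum.swap)
  also have "\<dots> = (\<Sum>i\<in>UNIV. \<Sum>j\<in>UNIV. \<Sum>l\<in>UNIV. v $ i * w $ j * z $ l * Der G u (axis i 1) $ j $ l)"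
    by (intro sum.cong refl sum.swap)
  also have "(\<Sum>l\<in>UNIV. \<Sum>i\<in>UNIV. \<Sum>j\<in>UNIV. w $ j * v $ i * z $ l * Der G u (axis j 1) $ i $ l) =
    (\<Sum>l\<in>UNIV. \<Sum>j\<in>UNIV. \<Sum>i\<in>UNIV. w $ j * v $ i * z $ l * Der G u (axis j 1) $ i $ l)"
    by (intro sum.cong refl sum.swap)
  also have "\<dots> = (\<Sum>j\<in>UNIV. \<Sum>l\<in>UNIV. \<Sum>i\<in>UNIV. w $ j * v $ i * z $ l * Der G u (axis j 1) $ i $ l)"
    by (rule sum.swap)
  also have "\<dots> = (\<Sum>j\<in>UNIV. \<Sum>i\<in>UNIV. \<Sum>l\<in>UNIV. w $ j * v $ i * z $ l * Der G u (axis j 1) $ i $ l)"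
    by (intro sum.cong refl sum.swap)
  finally show ?thesis
    by (simp add: gram_deriv_expand[OF u])
qed

lemma christoffel_commute: "u \<in> U \<Longrightarrow> christoffel G u v w = christoffel G u w v"
proof (rule gram_eqI)
  show "ip (G u) (christoffel G u v w) z = ip (G u) (christoffel G u w v) z" if "u \<in> U" for z
    using christoffel_first_kind[OF that, of v w z] christoffel_first_kind[OF that, of w v z]
      gram_deriv_commute[OF that, of z v w] by simp
qed

text \<open>Metric compatibility along a map: in the sum of the two Koszul formulas with
  \<open>X u\<close> and \<open>Y u\<close> exchanged, only the derivative of the metric in the
  direction \<open>Der f u v\<close> survives.\<close>

lemma ip_cov_along:
  assumes "f u \<in> U" "f differentiable (at u)" "X differentiable (at u)" "Y differentiable (at u)"
  shows "Der (\<lambda>u. ip (G (f u)) (X u) (Y u)) u v =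
    ip (G (f u)) (cov_along G f X u v) (Y u) + ip (G (f u)) (X u) (cov_along G f Y u v)"
proof -
  have dG: "((\<lambda>u. G (f u)) has_derivative (\<lambda>v. Der G (f u) (Der f u v))) (at u)"
    by (rule has_derivative_compose[OF has_derivative_Der[OF assms(2)]
          smooth_on_has_derivative[OF smooth_gram assms(1)]])
  have "Der (\<lambda>u. ip (G (f u)) (X u) (Y u)) u v =
    ip (Der G (f u) (Der f u v)) (X u) (Y u) + ip (G (f u)) (Der X u v) (Y u) + ip (G (f u)) (X u) (Der Y u v)"
    using fun_cong[OF Der_eqI[OF ip_has_derivative[OF dG has_derivative_Der[OF assms(3)]
      has_derivative_Der[OF assms(4)]]], of v] by simp
  moreover have "ip (Der G (f u) (Der f u v)) (X u) (Y u) =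
     ip (G (f u)) (christoffel G (f u) (Der f u v) (X u)) (Y u) +
     ip (G (f u)) (X u) (christoffel G (f u) (Der f u v) (Y u))"
    using christoffel_first_kind[OF assms(1), of "Der f u v" "X u" "Y u"]
      christoffel_first_kind[OF assms(1), of "Der f u v" "Y u" "X u"]
      gram_deriv_commute[OF assms(1)] gram_commute[OF assms(1), of "X u"]
    by (simp add: gram_deriv_commute[OF assms(1), of _ "Y u" "X u"])
  ultimately show ?thesis by (simp add: cov_along_def ip_simps)
qed

lemma smooth_christoffel_symbol: "smooth_on U (\<lambda>u. christoffel_symbol G u i j k)"
  unfolding christoffel_symbol_def
  by (intro smooth_on_divide smooth_on_sum smooth_on_mult smooth_on_add smooth_on_diff smooth_on_nth
      smooth_on_Der smooth_on_matrix_inv smooth_on_const gram_invertible open_dom smooth_gram) auto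

lemma smooth_cov_along:
  assumes "open W" "f ` W \<subseteq> U" "smooth_on W f" "smooth_on W X"
  shows "smooth_on W (\<lambda>u. cov_along G f X u v)"
  unfolding cov_along_def christoffel_def
  by (intro smooth_on_add smooth_on_vec smooth_on_sum smooth_on_mult smooth_on_nth assms
      smooth_on_Der smooth_on_compose[OF open_dom assms(1-3) smooth_christoffel_symbol])

end

lemma christoffel_expand:
  "christoffel G u v w = (\<Sum>i\<in>UNIV. \<Sum>j\<in>UNIV. (v $ i * w $ j) *\<^sub>R (\<chi> k. christoffel_symbol G u i j k))"
  by (simp add: christoffel_def vec_eq_iff mult_ac)

lemma christoffel_bilinear: "bilinear (christoffel G u)"
  unfolding bilinear_def christoffel_def
  by (auto intro!: linearI simp: vec_eq_iff algebra_simps sum.distrib sum_distrib_left)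

lemma cov_along_field:
  assumes "f differentiable (at u)" "X differentiable (at (f u))"
  shows "cov_along G f (\<lambda>u. X (f u)) u v = cov G X (f u) (Der f u v)"
  by (simp add: cov_along_def cov_def Der_compose[OF assms])

section \<open>Curvature along a map\<close>

context coordinate_metric
begin

lemma Der_christoffel_along:
  fixes f :: "real^'m::finite \<Rightarrow> real^'n"
  assumes "f u \<in> U" "f differentiable (at u)" "X differentiable (at u)" "Y differentiable (at u)"
  shows "Der (\<lambda>u. christoffel G (f u) (X u) (Y u)) u v =
    Der (\<lambda>y. christoffel G y (X u) (Y u)) (f u) (Der f u v) +
    christoffel G (f u) (Der X u v) (Y u) + christoffel G (f u) (X u) (Der Y u v)"
proof -
  define C where "C i j y = (\<chi> k. christoffel_symbol G y i j k)" for i j y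
  have "smooth_on U (C i j)" for i j
    unfolding C_def[abs_def] by (intro smooth_on_vec smooth_christoffel_symbol open_dom)
  then have dC: "(C i j has_derivative Der (C i j) (f u)) (at (f u))" for i j
    using smooth_on_has_derivative assms(1) by blast
  have dCf: "((\<lambda>u. C i j (f u)) has_derivative (\<lambda>v. Der (C i j) (f u) (Der f u v))) (at u)" for i j
    by (rule has_derivative_compose[OF has_derivative_Der[OF assms(2)] dC])
  have comp: "((\<lambda>u. X u $ i) has_derivative (\<lambda>v. Der X u v $ i)) (at u)"
    if "X differentiable (at u)" for X :: "real^'m \<Rightarrow> real^'n" and i
    by (rule bounded_linear.has_derivative[OF bounded_linear_vec_nth has_derivative_Der[OF that]])
  have 1: "((\<lambda>u. christoffel G (f u) (X u) (Y u)) has_derivative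
     (\<lambda>v. \<Sum>i\<in>UNIV. \<Sum>j\<in>UNIV. (X u $ i * Y u $ j) *\<^sub>R Der (C i j) (f u) (Der f u v) +
        (X u $ i * Der Y u v $ j + Der X u v $ i * Y u $ j) *\<^sub>R C i j (f u))) (at u)"
    unfolding christoffel_expand C_def[symmetric]
    by (intro has_derivative_sum has_derivative_scaleR has_derivative_mult comp assms(3,4) dCf)
  have 2: "((\<lambda>y. christoffel G y x z) has_derivative
     (\<lambda>v. \<Sum>i\<in>UNIV. \<Sum>j\<in>UNIV. (x $ i * z $ j) *\<^sub>R Der (C i j) (f u) v)) (at (f u))" for x z
    unfolding christoffel_expand C_def[symmetric]
    by (intro has_derivative_sum has_derivative_scaleR_right dC)
  show ?thesis
    unfolding Der_eqI[OF 1] Der_eqI[OF 2]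
    by (simp add: christoffel_expand C_def[symmetric] sum.distrib scaleR_add_left)
qed

lemma cov_along_commute:
  assumes "open W" "f ` W \<subseteq> U" "smooth_on W f" "u \<in> W"
  shows "cov_along G f (\<lambda>u. Der f u w) u v = cov_along G f (\<lambda>u. Der f u v) u w"
  using assms christoffel_commute[of "f u"] Der_commute[OF assms(1,4,3), of w v]
  by (auto simp: cov_along_def)

text \<open>\<open>curvature\<close> differentiates constant fields on the target, while
  \<open>X\<close> exists only along \<open>f\<close>, which need not be an immersion. The product
  rule \<open>Der_christoffel_along\<close> isolates the derivatives of the symbols. Second
  derivatives of \<open>f\<close> and \<open>X\<close> are symmetric in \<open>v\<close> and
  \<open>w\<close>, and so is the sum of the terms containing first derivatives of \<open>X\<close>;
  all of these cancel.\<close>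

lemma cov_along_curvature:
  fixes f :: "real^'m::finite \<Rightarrow> real^'n"
  assumes "open W" "f ` W \<subseteq> U" "smooth_on W f" "smooth_on W X" "u \<in> W"
  shows "cov_along G f (\<lambda>u. cov_along G f X u w) u v - cov_along G f (\<lambda>u. cov_along G f X u v) u w =
    curvature G (f u) (Der f u v) (Der f u w) (X u)"
proof -
  have fu: "f u \<in> U" using assms by auto
  have df: "f differentiable (at u)" using assms smooth_on_differentiable by blast
  have dX: "X differentiable (at u)" using assms smooth_on_differentiable by blast
  have dDf: "(\<lambda>u. Der f u w) differentiable (at u)" for w
    using smooth_on_differentiable[OF smooth_on_Der[OF assms(3)] assms(5)] .
  have dDX: "(\<lambda>u. Der X u w) differentiable (at u)" for w
    using smooth_on_differentiable[OF smooth_on_Der[OF assms(4)] assms(5)] .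
  have sC: "smooth_on W (\<lambda>u. christoffel G (f u) (Der f u w) (X u))" for w
    unfolding christoffel_def
    by (intro smooth_on_vec smooth_on_sum smooth_on_mult smooth_on_nth assms
      smooth_on_Der smooth_on_compose[OF open_dom assms(1-3) smooth_christoffel_symbol])
  have dC: "(\<lambda>u. christoffel G (f u) (Der f u w) (X u)) differentiable (at u)" for w
    using smooth_on_differentiable[OF sC assms(5)] .
  have Dsum: "Der (\<lambda>u. cov_along G f X u w) u v =
     Der (\<lambda>u. Der X u w) u v + Der (\<lambda>u. christoffel G (f u) (Der f u w) (X u)) u v" for v w
    using fun_cong[OF Der_eqI[OF has_derivative_add[OF has_derivative_Der[OF dDX[of w]] has_derivative_Der[OF dC[of w]]]]]
    by (simp add: cov_along_def)
  have Dc: "cov G (\<lambda>u. cov G (\<lambda>_. z) u y) (f u) x =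
     Der (\<lambda>u. christoffel G u y z) (f u) x + christoffel G (f u) x (christoffel G (f u) y z)" for x y z
    by (simp add: cov_def cov_along_def)
  show ?thesis
    unfolding curvature_def Dc cov_along_def[of G f "\<lambda>u. cov_along G f X u _"] Dsum
      Der_christoffel_along[OF fu df dDf dX]
    unfolding cov_along_def Der_commute[OF assms(1,5,4), of w v] Der_commute[OF assms(1,5,3), of w v]
    by (simp add: bilinear_radd[OF christoffel_bilinear])
qed

lemma curvature_linear:
  assumes u: "u \<in> U"
  shows "linear (\<lambda>x. curvature G u x y z)"
proof -
  have sm: "(\<lambda>u. christoffel G u x z) differentiable (at u)" for x
    unfolding christoffel_def
    by (rule smooth_on_differentiable[OF _ u])
      (intro smooth_on_vec smooth_on_sum smooth_on_mult smooth_on_const open_dom smooth_christoffel_symbol)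
  have expand: "curvature G u x y z = Der (\<lambda>u. christoffel G u y z) u x + christoffel G u x (christoffel G u y z)
      - (Der (\<lambda>u. christoffel G u x z) u y + christoffel G u y (christoffel G u x z))" for x
    by (simp add: curvature_def cov_def cov_along_def)
  have lin: "linear (Der (\<lambda>u. christoffel G u y z) u)" by (rule linear_frechet_derivative[OF sm])
  have add: "Der (\<lambda>u. christoffel G u a z + christoffel G u b z) u y = Der (\<lambda>u. christoffel G u a z) u y + Der (\<lambda>u. christoffel G u b z) u y" for a b
    using fun_cong[OF Der_eqI[OF has_derivative_add[OF has_derivative_Der[OF sm[of a]] has_derivative_Der[OF sm[of b]]]], of y] .
  have scale: "Der (\<lambda>u. c *\<^sub>R christoffel G u a z) u y = c *\<^sub>R Der (\<lambda>u. christoffel G u a z) u y" for a c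
    using fun_cong[OF Der_eqI[OF has_derivative_scaleR_right[OF has_derivative_Der[OF sm[of a]]]], of c y] .
  show ?thesis
    unfolding expand
    by (rule linearI; simp only: add scale linear_add[OF lin] linear_cmul[OF lin]
        bilinear_ladd[OF christoffel_bilinear] bilinear_radd[OF christoffel_bilinear]
        bilinear_lmul[OF christoffel_bilinear] bilinear_rmul[OF christoffel_bilinear];
        simp add: algebra_simps)
qed

end

lemma curvature_skew: "curvature G u x y z = - curvature G u y x z"
  by (simp add: curvature_def)

text \<open>Linearity in one slot and skew-symmetry give bilinearity, and on a plane a skew form is
  a determinant times a single value. For the curvature it is thus enough to know linearity in the
  first slot.\<close>

lemma skew_form_frame:
  fixes K :: "'v::real_vector \<Rightarrow> 'v \<Rightarrow> real"
  assumes "\<And>y. linear (\<lambda>x. K x y)" "\<And>x y. K x y = - K y x"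
  shows "K (a *\<^sub>R x + b *\<^sub>R y) (c *\<^sub>R x + d *\<^sub>R y) = (a * d - b * c) * K x y"
proof -
  have l: "K (a *\<^sub>R x + b *\<^sub>R y) z = a * K x z + b * K y z" for a b x y z
    using linear_add[OF assms(1)] linear_cmul[OF assms(1)] by simp
  have r: "K z (a *\<^sub>R x + b *\<^sub>R y) = a * K z x + b * K z y" for a b x y z
    using l[of a x b y z] assms(2)[of z] by (simp add: algebra_simps)
  have "K x x = 0" "K y y = 0" "K y x = - K x y"
    using assms(2)[of x x] assms(2)[of y y] assms(2)[of y x] by auto
  then show ?thesis by (simp add: l r algebra_simps)
qed

section \<open>The fibration in coordinates\<close>

text \<open>Preimages of the two unit vectors together with \<open>\<xi>\<close> form a basis of the
  source. Applying \<open>f\<close> to the expansion of \<open>v\<close> shows that the first two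
  coefficients vanish.\<close>

lemma kernel_line:
  fixes f :: "real^3 \<Rightarrow> real^2"
  assumes lin: "linear f" and "surj f" "f \<xi> = 0" "\<xi> \<noteq> 0" "f v = 0"
  obtains c where "v = c *\<^sub>R \<xi>"
proof -
  obtain a b where a: "f a = axis 1 1" and b: "f b = axis 2 1" using \<open>surj f\<close> by (metis surjD)
  have ne: "(axis 1 1 :: real^2) \<noteq> k *\<^sub>R axis 2 1" for k
  proof -
    have "(axis 1 1 :: real^2) $ 1 \<noteq> (k *\<^sub>R (axis 2 1 :: real^2)) $ 1" by (simp add: axis_def)
    then show ?thesis by metis
  qed
  have 1: "b \<notin> span {\<xi>}"
    using b assms linear_cmul[OF lin] by (auto simp: span_singleton)
  have 2: "a \<notin> span {b, \<xi>}"
  proof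
    assume "a \<in> span {b, \<xi>}"
    then obtain k l where "a - k *\<^sub>R b = l *\<^sub>R \<xi>" by (auto simp: span_insert span_singleton)
    then have "f a - k *\<^sub>R f b = 0" using assms(3) linear_diff[OF lin] linear_cmul[OF lin] by (metis scaleR_zero_right)
    then show False using a b ne[of k] by simp
  qed
  have ind: "independent {a, b, \<xi>}"
    by (intro independent_insertI 1 2 independent_empty) (use assms(4) in simp)
  have "b \<noteq> \<xi>" "a \<noteq> b" "a \<noteq> \<xi>"
    using 1 2 span_base[of \<xi> "{\<xi>}"] span_base[of b "{b, \<xi>}"] span_base[of \<xi> "{b, \<xi>}"] by auto
  then have "card {a, b, \<xi>} = 3" by simp
  then have "UNIV \<subseteq> span {a, b, \<xi>}"
    by (intro card_ge_dim_independent) (use ind in auto)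
  then have "v \<in> span {a, b, \<xi>}" by blast
  then obtain k l m where v: "v = k *\<^sub>R a + l *\<^sub>R b + m *\<^sub>R \<xi>"
    by (auto simp: span_insert span_singleton algebra_simps)
  then have "k *\<^sub>R axis 1 1 + l *\<^sub>R axis 2 1 = (0 :: real^2)"
    using assms(3,5) a b linear_add[OF lin] linear_cmul[OF lin] by simp
  then have "k = 0" "l = 0" by (auto simp: vec_eq_iff axis_def forall_2)
  with v show thesis using that[of m] by simp
qed

section \<open>Orthonormal frames of a metric in dimension two\<close>

definition orthonormal :: "real^2^2 \<Rightarrow> real^2 \<Rightarrow> real^2 \<Rightarrow> bool" where
  "orthonormal A a b \<longleftrightarrow> ip A a a = 1 \<and> ip A b b = 1 \<and> ip A a b = 0"

lemma orthonormal_expand: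
  assumes A: "transpose A = A" and o: "orthonormal A a b"
  shows "x = ip A x a *\<^sub>R a + ip A x b *\<^sub>R b"
proof -
  have ab: "ip A a a = 1" "ip A b b = 1" "ip A a b = 0" "ip A b a = 0"
    using o ip_commute[OF A] by (auto simp: orthonormal_def)
  have ne: "b \<noteq> 0" "a \<notin> span {b}"
    using ab by (auto simp: ip_simps span_singleton)
  then have ind: "independent {a, b}" by (intro independent_insertI independent_empty) auto
  have "a \<noteq> b" using ne(2) span_base[of b "{b}"] by auto
  then have "card {a, b} = 2" by simp
  then have "UNIV \<subseteq> span {a, b}"
    by (intro card_ge_dim_independent) (use ind in auto)
  then have "x \<in> span {a, b}" by blast
  then obtain k l where "x = k *\<^sub>R a + l *\<^sub>R b"
    by (auto simp: span_insert span_singleton algebra_simps)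
  then show ?thesis by (simp add: ip_simps ab)
qed

lemma orthonormal_ip:
  assumes "transpose A = A" "orthonormal A a b"
  shows "ip A x y = ip A x a * ip A y a + ip A x b * ip A y b"
  by (subst orthonormal_expand[OF assms, of y]) (simp add: ip_simps)

text \<open>Gram-Schmidt for the coordinate vectors with respect to the varying inner product
  \<open>A u\<close>; positivity keeps the denominators nonzero, so the result is smooth on all of
  \<open>W\<close>.\<close>

lemma orthonormal_frame:
  fixes A :: "real^2 \<Rightarrow> real^2^2"
  assumes "open W" "smooth_on W A" "\<And>u. u \<in> W \<Longrightarrow> transpose (A u) = A u"
    and pos: "\<And>u v. u \<in> W \<Longrightarrow> v \<noteq> 0 \<Longrightarrow> 0 < ip (A u) v v"
  obtains a b where "smooth_on W a" "smooth_on W b" "\<And>u. u \<in> W \<Longrightarrow> orthonormal (A u) (a u) (b u)"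
proof -
  define e :: "2 \<Rightarrow> real^2" where "e i = axis i 1" for i
  define w where "w u = e 2 - (ip (A u) (e 1) (e 2) / ip (A u) (e 1) (e 1)) *\<^sub>R e 1" for u
  define unit where "unit u x = (1 / sqrt (ip (A u) x x)) *\<^sub>R x" for u x
  have e1: "ip (A u) (e 1) (e 1) > 0" if "u \<in> W" for u
    using pos[OF that, of "e 1"] by (simp add: e_def)
  have "w u $ 2 = 1" for u by (simp add: w_def e_def axis_def)
  then have "w u \<noteq> 0" for u by (metis zero_index zero_neq_one)
  then have w: "ip (A u) (w u) (w u) > 0" if "u \<in> W" for u using pos that by blast
  have sw: "smooth_on W w"
    unfolding w_def using e1
    by (intro smooth_on_diff smooth_on_scaleR smooth_on_divide smooth_on_ip smooth_on_const assms(1,2)) force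
  have unit: "ip (A u) (unit u x) (unit u x) = 1" if "ip (A u) x x > 0" for u x
    using that by (simp add: unit_def ip_simps)
  have s: "smooth_on W (\<lambda>u. unit u (x u))" if "smooth_on W x" "\<And>u. u \<in> W \<Longrightarrow> ip (A u) (x u) (x u) > 0" for x
  proof -
    have "sqrt (ip (A u) (x u) (x u)) \<noteq> 0" if "u \<in> W" for u
      using \<open>\<And>u. u \<in> W \<Longrightarrow> ip (A u) (x u) (x u) > 0\<close>[OF that] by simp
    then show ?thesis
      unfolding unit_def
      by (intro smooth_on_scaleR smooth_on_divide smooth_on_sqrt smooth_on_ip smooth_on_const assms(1,2) that)
  qed
  show thesis
  proof
    show "smooth_on W (\<lambda>u. unit u (e 1))" "smooth_on W (\<lambda>u. unit u (w u))"
      using s[OF smooth_on_const e1] s[OF sw w] by auto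
    show "orthonormal (A u) (unit u (e 1)) (unit u (w u))" if "u \<in> W" for u
      using unit[OF e1] unit[OF w] that e1[OF that]
      by (simp add: orthonormal_def) (simp add: unit_def w_def ip_simps)
  qed
qed

section \<open>Riemannian submersions with a unit vertical field\<close>

locale unit_fibration =
  tot: coordinate_metric G U + base: coordinate_metric g V
  for G :: "3 gram" and U and g :: "2 gram" and V +
  fixes p :: "real^3 \<Rightarrow> real^2" and \<xi> :: "real^3 \<Rightarrow> real^3" and \<kappa> \<tau> :: real
  assumes p_smooth: "smooth_on U p" and p_maps: "p ` U \<subseteq> V"
    and p_surj: "u \<in> U \<Longrightarrow> surj (Der p u)"
    and p_isometric: "u \<in> U \<Longrightarrow> (\<And>k. Der p u k = 0 \<Longrightarrow> ip (G u) v k = 0) \<Longrightarrow>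
      (\<And>k. Der p u k = 0 \<Longrightarrow> ip (G u) w k = 0) \<Longrightarrow>
      ip (g (p u)) (Der p u v) (Der p u w) = ip (G u) v w"
    and xi_smooth: "smooth_on U \<xi>"
    and xi_unit: "u \<in> U \<Longrightarrow> ip (G u) (\<xi> u) (\<xi> u) = 1"
    and xi_vertical: "u \<in> U \<Longrightarrow> Der p u (\<xi> u) = 0"
    and xi_cov: "u \<in> U \<Longrightarrow> cov G \<xi> u v = \<tau> *\<^sub>R wedge (G u) v (\<xi> u)"
    and base_curvature: "y \<in> V \<Longrightarrow> ip (g y) (curvature g y a b b) a =
      \<kappa> * (ip (g y) a a * ip (g y) b b - (ip (g y) a b)\<^sup>2)"
begin

definition \<eta> :: "real^3 \<Rightarrow> real^3 \<Rightarrow> real" where "\<eta> u v = ip (G u) v (\<xi> u)"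

text \<open>The covariant derivative of the form \<open>\<eta>\<close>. By \<open>Omega_skew\<close>
  it is half the exterior derivative of \<open>\<eta>\<close>, so it plays the role of the curvature
  form of the fibration.\<close>

definition \<Omega> :: "real^3 \<Rightarrow> real^3 \<Rightarrow> real^3 \<Rightarrow> real" where "\<Omega> u v w = ip (G u) (cov G \<xi> u v) w"

lemma p_linear: "u \<in> U \<Longrightarrow> linear (Der p u)"
  by (rule smooth_on_linear_Der[OF p_smooth])

lemma xi_nonzero: "u \<in> U \<Longrightarrow> \<xi> u \<noteq> 0"
  using xi_unit[of u] by (auto simp: ip_simps)

lemma vertical:
  assumes "u \<in> U" "Der p u v = 0"
  obtains c where "v = c *\<^sub>R \<xi> u"
  using kernel_line[OF p_linear p_surj xi_vertical xi_nonzero assms(2)] assms(1) by blast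

text \<open>Subtracting the vertical part leaves the image under \<open>Der p u\<close> unchanged
  and makes the vector horizontal, because the kernel of \<open>Der p u\<close> is spanned by
  \<open>\<xi> u\<close>; then \<open>p_isometric\<close> applies.\<close>

lemma ip_base:
  assumes u: "u \<in> U"
  shows "ip (g (p u)) (Der p u v) (Der p u w) = ip (G u) v w - \<eta> u v * \<eta> u w"
proof -
  define h where "h v = v - \<eta> u v *\<^sub>R \<xi> u" for v
  have "ip (G u) (h v) k = 0" if k: "Der p u k = 0" for v k
  proof -
    obtain c where "k = c *\<^sub>R \<xi> u" using vertical[OF u k] .
    then show ?thesis using xi_unit[OF u] by (simp add: h_def ip_simps \<eta>_def)
  qed
  then have "ip (g (p u)) (Der p u (h v)) (Der p u (h w)) = ip (G u) (h v) (h w)"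
    using p_isometric[OF u] by blast
  moreover have "Der p u (h v) = Der p u v" for v
    using linear_diff[OF p_linear[OF u]] linear_cmul[OF p_linear[OF u]] xi_vertical[OF u]
    by (simp add: h_def)
  moreover have "ip (G u) (h v) (h w) = ip (G u) v w - \<eta> u v * \<eta> u w"
    using xi_unit[OF u] tot.gram_commute[OF u, of "\<xi> u" w] by (simp add: h_def ip_simps \<eta>_def)
  ultimately show ?thesis by simp
qed

lemma Omega_wedge:
  assumes u: "u \<in> U"
  shows "\<Omega> u v w = \<tau> * sqrt (det (G u)) * (cross3 v (\<xi> u) \<bullet> w)"
proof -
  have "ip (G u) (matrix_inv (G u) *v z) w = z \<bullet> w" for z
    unfolding tot.gram_commute[OF u, of _ w]
    by (simp add: ip_def matrix_vector_mul_assoc matrix_inv_right[OF tot.gram_invertible[OF u]] inner_commute)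
  then show ?thesis by (simp add: \<Omega>_def xi_cov[OF u] wedge_def ip_simps)
qed

lemma Omega_skew: "u \<in> U \<Longrightarrow> \<Omega> u v w = - \<Omega> u w v"
  by (simp add: Omega_wedge cross3_simps)

lemma Omega_xi: "u \<in> U \<Longrightarrow> \<Omega> u v (\<xi> u) = 0"
  by (simp add: Omega_wedge dot_cross_self)

lemma Omega_linear:
  assumes "u \<in> U"
  shows "\<Omega> u (a *\<^sub>R v + b *\<^sub>R w) z = a * \<Omega> u v z + b * \<Omega> u w z"
    and "\<Omega> u z (a *\<^sub>R v + b *\<^sub>R w) = a * \<Omega> u z v + b * \<Omega> u z w"
  by (simp_all add: Omega_wedge[OF assms] cross3_simps)

text \<open>For the matrix \<open>M\<close> with rows \<open>x\<close>, \<open>y\<close>,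
  \<open>z\<close> the matrix on the right is \<open>M ** A ** transpose M\<close>. The order of the
  triple product gives \<open>det M\<close> a minus sign, which the square removes.\<close>

lemma gram_determinant:
  fixes A :: "real^3^3"
  assumes "transpose A = A"
  shows "det A * (cross3 x z \<bullet> y)\<^sup>2 = det (vector [vector [ip A x x, ip A x y, ip A x z],
    vector [ip A y x, ip A y y, ip A y z], vector [ip A z x, ip A z y, ip A z z]] :: real^3^3)"
proof -
  define M :: "real^3^3" where "M = vector [x, y, z]"
  have "det (M ** A ** transpose M) = det A * (det M)\<^sup>2"
    by (simp add: det_mul det_transpose power2_eq_square)
  moreover have "det M = - (cross3 x z \<bullet> y)"
    by (simp add: M_def det_3 cross3_simps)
  moreover have "M ** A ** transpose M = vector [vector [ip A x x, ip A x y, ip A x z],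
    vector [ip A y x, ip A y y, ip A y z], vector [ip A z x, ip A z y, ip A z z]]"
    by (simp add: M_def vec_eq_iff forall_3 matrix_matrix_mult_def transpose_def ip_sum_expand sum_3 algebra_simps)
  ultimately show ?thesis by simp
qed

text \<open>The lifts \<open>a\<close> and \<open>b\<close> need not be horizontal: in the Gram
  determinant of \<open>a\<close>, \<open>b\<close>, \<open>\<xi> u\<close> their vertical parts
  cancel and the value is 1. Only the square is determined, since the frame may or may not agree
  with the orientation behind the cross product.\<close>

lemma Omega_orthonormal:
  assumes u: "u \<in> U" and o: "orthonormal (g (p u)) (Der p u a) (Der p u b)"
  shows "(\<Omega> u a b)\<^sup>2 = \<tau>\<^sup>2"
proof -
  have 1: "ip (G u) a a = 1 + (\<eta> u a)\<^sup>2" "ip (G u) b b = 1 + (\<eta> u b)\<^sup>2" "ip (G u) a b = \<eta> u a * \<eta> u b"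
    using o ip_base[OF u] by (auto simp: orthonormal_def power2_eq_square)
  have "det (G u) * (cross3 a (\<xi> u) \<bullet> b)\<^sup>2 = 1"
    unfolding gram_determinant[OF tot.gram_sym[OF u]]
    using 1 tot.gram_commute[OF u, of b a] tot.gram_commute[OF u, of "\<xi> u"] xi_unit[OF u]
    by (simp add: det_3 \<eta>_def[symmetric] power2_eq_square algebra_simps)
  moreover from this have "det (G u) > 0"
    by (metis mult_nonpos_nonneg not_le not_one_le_zero zero_le_power2)
  ultimately show ?thesis
    by (simp add: Omega_wedge[OF u] power_mult_distrib mult.assoc)
qed

text \<open>\<open>\<Omega>\<close> is skew and annihilates \<open>\<xi>\<close>, so it factors
  through the projection, and on a two-dimensional base every skew form is a multiple of the area
  form.\<close>

lemma Omega_base: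
  assumes u: "u \<in> U" and o: "orthonormal (g (p u)) (Der p u a) (Der p u b)"
  defines "q \<equiv> \<lambda>x c. ip (g (p u)) (Der p u x) (Der p u c)"
  shows "\<Omega> u x y = \<Omega> u a b * (q x a * q y b - q x b * q y a)"
proof -
  have pu: "p u \<in> V" using p_maps u by blast
  have "\<exists>c. x = 1 *\<^sub>R (q x a *\<^sub>R a + q x b *\<^sub>R b) + c *\<^sub>R \<xi> u" for x
  proof -
    have "Der p u (x - (q x a *\<^sub>R a + q x b *\<^sub>R b)) = 0"
      using orthonormal_expand[OF base.gram_sym[OF pu] o, of "Der p u x"]
      by (simp add: linear_diff[OF p_linear[OF u]] linear_add[OF p_linear[OF u]]
          linear_cmul[OF p_linear[OF u]] q_def)
    then obtain c where "x - (q x a *\<^sub>R a + q x b *\<^sub>R b) = c *\<^sub>R \<xi> u" using vertical[OF u] by metis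
    then have "x = 1 *\<^sub>R (q x a *\<^sub>R a + q x b *\<^sub>R b) + c *\<^sub>R \<xi> u" by (simp add: algebra_simps)
    then show ?thesis ..
  qed
  then obtain c d where x: "x = 1 *\<^sub>R (q x a *\<^sub>R a + q x b *\<^sub>R b) + c *\<^sub>R \<xi> u"
    and y: "y = 1 *\<^sub>R (q y a *\<^sub>R a + q y b *\<^sub>R b) + d *\<^sub>R \<xi> u" by blast
  have xi: "\<Omega> u (\<xi> u) z = 0" for z using Omega_xi[OF u, of z] Omega_skew[OF u, of "\<xi> u" z] by simp
  have self: "\<Omega> u z z = 0" for z using Omega_skew[OF u, of z z] by simp
  have "\<Omega> u x y = \<Omega> u (1 *\<^sub>R (q x a *\<^sub>R a + q x b *\<^sub>R b) + c *\<^sub>R \<xi> u) (1 *\<^sub>R (q y a *\<^sub>R a + q y b *\<^sub>R b) + d *\<^sub>R \<xi> u)"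
    using x y by metis
  also have "\<dots> = \<Omega> u a b * (q x a * q y b - q x b * q y a)"
    unfolding Omega_linear[OF u] xi Omega_xi[OF u] self Omega_skew[OF u, of b a]
    by (simp add: algebra_simps)
  finally show ?thesis .
qed

text \<open>The base metric pulls back to \<open>G - \<eta> \<otimes> \<eta>\<close>; the Koszul formula, applied to both sides,
  compares the two connections.\<close>

lemma submersion_second_form:
  assumes u: "u \<in> U"
  shows "ip (g (p u)) (cov_along g p (\<lambda>u. Der p u y) u x) (Der p u z) =
    ip (g (p u)) (Der p u (christoffel G u x y)) (Der p u z) - \<eta> u y * \<Omega> u x z - \<eta> u x * \<Omega> u y z"
proof -
  let ?S = "\<lambda>x y. cov_along g p (\<lambda>u. Der p u y) u x"
  let ?\<Gamma> = "christoffel G u"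
  have pu: "p u \<in> V" using p_maps u by blast
  have dp: "p differentiable (at u)" and dDp: "(\<lambda>u. Der p u y) differentiable (at u)" for y
    using smooth_on_differentiable[OF p_smooth u] smooth_on_differentiable[OF smooth_on_Der[OF p_smooth] u] .
  have dxi: "\<xi> differentiable (at u)" using smooth_on_differentiable[OF xi_smooth u] .
  have D: "Der (\<lambda>u. ip (g (p u)) (Der p u y) (Der p u z)) u x =
     ip (g (p u)) (?S x y) (Der p u z) + ip (g (p u)) (Der p u y) (?S x z)" for x y z
    by (rule base.ip_cov_along[OF pu dp dDp dDp])
  have S: "?S x y = ?S y x" for x y
    by (rule base.cov_along_commute[OF tot.open_dom p_maps p_smooth u])
  have eta: "((\<lambda>u. \<eta> u y) has_derivative (\<lambda>x. \<eta> u (?\<Gamma> x y) + \<Omega> u x y)) (at u)" for y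
  proof -
    have "(\<lambda>u. \<eta> u y) differentiable (at u)"
      unfolding \<eta>_def
      by (rule smooth_on_differentiable[OF smooth_on_ip[OF tot.open_dom tot.smooth_gram smooth_on_const xi_smooth] u])
    moreover have "Der (\<lambda>u. \<eta> u y) u = (\<lambda>x. \<eta> u (?\<Gamma> x y) + \<Omega> u x y)"
      using tot.ip_cov_along[of "\<lambda>x. x" u "\<lambda>_. y" \<xi>] u dxi
      by (simp add: fun_eq_iff \<eta>_def \<Omega>_def cov_def cov_along_def tot.gram_commute[OF u, of y])
    ultimately show ?thesis by (simp add: frechet_derivative_works)
  qed
  have ipd: "((\<lambda>u. ip (G u) y z) has_derivative (\<lambda>x. ip (G u) (?\<Gamma> x y) z + ip (G u) y (?\<Gamma> x z))) (at u)" for y z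
  proof -
    have "(\<lambda>u. ip (G u) y z) differentiable (at u)"
      by (rule smooth_on_differentiable[OF smooth_on_ip[OF tot.open_dom tot.smooth_gram smooth_on_const smooth_on_const] u])
    moreover have "Der (\<lambda>u. ip (G u) y z) u = (\<lambda>x. ip (G u) (?\<Gamma> x y) z + ip (G u) y (?\<Gamma> x z))"
      using tot.ip_cov_along[of "\<lambda>x. x" u "\<lambda>_. y" "\<lambda>_. z"] u
      by (simp add: fun_eq_iff cov_along_def)
    ultimately show ?thesis by (simp add: frechet_derivative_works)
  qed
  have D': "Der (\<lambda>u. ip (g (p u)) (Der p u y) (Der p u z)) u x =
     ip (G u) (?\<Gamma> x y) z + ip (G u) y (?\<Gamma> x z) - ((\<eta> u (?\<Gamma> x y) + \<Omega> u x y) * \<eta> u z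
       + \<eta> u y * (\<eta> u (?\<Gamma> x z) + \<Omega> u x z))" for x y z
  proof -
    have h: "((\<lambda>u. ip (G u) y z - \<eta> u y * \<eta> u z) has_derivative
      (\<lambda>x. ip (G u) (?\<Gamma> x y) z + ip (G u) y (?\<Gamma> x z) -
        (\<eta> u y * (\<eta> u (?\<Gamma> x z) + \<Omega> u x z) + (\<eta> u (?\<Gamma> x y) + \<Omega> u x y) * \<eta> u z))) (at u)"
      by (intro has_derivative_diff has_derivative_mult eta ipd)
    have "Der (\<lambda>u. ip (g (p u)) (Der p u y) (Der p u z)) u = Der (\<lambda>u. ip (G u) y z - \<eta> u y * \<eta> u z) u"
      by (rule Der_cong[OF tot.open_dom u, symmetric]) (use h in \<open>auto simp: ip_base intro: differentiableI\<close>)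
    then show ?thesis by (simp add: Der_eqI[OF h])
  qed
  have \<Gamma>: "?\<Gamma> x y = ?\<Gamma> y x" for x y by (rule tot.christoffel_commute[OF u])
  have c: "ip (g (p u)) v w = ip (g (p u)) w v" for v w by (rule base.gram_commute[OF pu])
  have c': "ip (G u) v w = ip (G u) w v" for v w by (rule tot.gram_commute[OF u])
  \<comment> \<open>In \<open>e1 + e2 - e3\<close> the symmetry of \<open>?S\<close> leaves twice
    the wanted product on the base. Upstairs the two terms with \<open>\<eta> u z\<close> cancel
    since \<open>\<Omega>\<close> is skew, and the other terms with \<open>\<Omega>\<close>
    double.\<close>
  note e1 = D[of y z x, unfolded D'] and e2 = D[of x z y, unfolded D'] and e3 = D[of x y z, unfolded D']
  have "2 * ip (g (p u)) (?S x y) (Der p u z) =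
     2 * (ip (G u) (?\<Gamma> x y) z - \<eta> u (?\<Gamma> x y) * \<eta> u z) - 2 * (\<eta> u y * \<Omega> u x z) - 2 * (\<eta> u x * \<Omega> u y z)"
    using e1 e2 e3 S[of y x] S[of z x] S[of z y] \<Gamma>[of y x] \<Gamma>[of z x] \<Gamma>[of z y]
      c[of "Der p u y" "?S x z"] c[of "Der p u x" "?S y z"]
      c'[of y "?\<Gamma> x z"] c'[of x "?\<Gamma> y z"]
      Omega_skew[OF u, of y x] Omega_skew[OF u, of z x] Omega_skew[OF u, of z y]
    by (simp add: algebra_simps)
  then show ?thesis by (simp add: ip_base[OF u])
qed

text \<open>The second derivatives of \<open>p\<close> created by the product rule are eliminated by
  \<open>submersion_second_form\<close>. The two corrections measure the failure of projection to
  commute with the connections; they vanish when \<open>X u\<close> and \<open>Der f u v\<close> are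
  both horizontal.\<close>

lemma cov_along_project:
  fixes f :: "real^'m::finite \<Rightarrow> real^3"
  assumes fu: "f u \<in> U" and df: "f differentiable (at u)" and dX: "X differentiable (at u)"
  shows "ip (g (p (f u))) (cov_along g (\<lambda>u. p (f u)) (\<lambda>u. Der p (f u) (X u)) u v) (Der p (f u) z) =
    ip (g (p (f u))) (Der p (f u) (cov_along G f X u v)) (Der p (f u) z)
    - \<eta> (f u) (X u) * \<Omega> (f u) (Der f u v) z - \<eta> (f u) (Der f u v) * \<Omega> (f u) (X u) z"
proof -
  have dp: "p differentiable (at (f u))" using smooth_on_differentiable[OF p_smooth fu] .
  have "cov_along g (\<lambda>u. p (f u)) (\<lambda>u. Der p (f u) (X u)) u v =
     cov_along g p (\<lambda>y. Der p y (X u)) (f u) (Der f u v) + Der p (f u) (Der X u v)"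
    by (simp add: cov_along_def Der_Der_along[OF p_smooth fu tot.open_dom df dX] Der_compose[OF df dp])
  moreover have "Der p (f u) (cov_along G f X u v) =
     Der p (f u) (christoffel G (f u) (Der f u v) (X u)) + Der p (f u) (Der X u v)"
    by (simp add: cov_along_def linear_add[OF p_linear[OF fu]])
  ultimately show ?thesis
    by (simp add: ip_simps submersion_second_form[OF fu])
qed

end

section \<open>Umbilic surfaces\<close>

text \<open>The commutator of the mixed derivatives of \<open>p\<close> and \<open>q\<close>; the letter followed by a digit denotes a
  component or derivative in that coordinate direction.\<close>

lemma codazzi_algebra:
  fixes \<kappa> \<mu> \<nu> :: real
  assumes "a21 - l1 * c2 = a12 - l2 * c1" "c21 + l1 * a2 = c12 + l2 * a1"
    and "n21 - n12 = - 2 * \<mu> * (a1 * c2 - c1 * a2)" "l21 - l12 = - \<kappa> * (a1 * c2 - c1 * a2)"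
    and \<nu>: "\<nu>1 = - h * n1 - \<mu> * (a1 * q - c1 * p)" "\<nu>2 = - h * n2 - \<mu> * (a2 * q - c2 * p)"
    and p: "p1 = - h * a1 - \<nu> * \<mu> * c1 - n1 * \<mu> * q + l1 * q" "p2 = - h * a2 - \<nu> * \<mu> * c2 - n2 * \<mu> * q + l2 * q"
    and q: "q1 = - h * c1 + \<nu> * \<mu> * a1 + n1 * \<mu> * p - l1 * p" "q2 = - h * c2 + \<nu> * \<mu> * a2 + n2 * \<mu> * p - l2 * p"
    and n: "\<nu> * n1 = - (p * a1 + q * c1)" "\<nu> * n2 = - (p * a2 + q * c2)"
    and "- (h1 * a2 + h * a21) - \<mu> * (\<nu>1 * c2 + \<nu> * c21) - \<mu> * (n21 * q + n2 * q1) + (l21 * q + l2 * q1) =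
      - (h2 * a1 + h * a12) - \<mu> * (\<nu>2 * c1 + \<nu> * c12) - \<mu> * (n12 * q + n1 * q2) + (l12 * q + l1 * q2)"
    and "- (h1 * c2 + h * c21) + \<mu> * (\<nu>1 * a2 + \<nu> * a21) + \<mu> * (n21 * p + n2 * p1) - (l21 * p + l2 * p1) =
      - (h2 * c1 + h * c12) + \<mu> * (\<nu>2 * a1 + \<nu> * a12) + \<mu> * (n12 * p + n1 * p2) - (l12 * p + l1 * p2)"
  shows "h1 * a2 - h2 * a1 = - (\<kappa> - 4 * \<mu>\<^sup>2) * (a1 * c2 - c1 * a2) * q"
    and "h1 * c2 - h2 * c1 = (\<kappa> - 4 * \<mu>\<^sup>2) * (a1 * c2 - c1 * a2) * p"
proof -
  have a21: "a21 = a12 - l2 * c1 + l1 * c2" and c21: "c21 = c12 + l2 * a1 - l1 * a2"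
    and n21: "n21 = n12 - 2 * \<mu> * (a1 * c2 - c1 * a2)" and l21: "l21 = l12 - \<kappa> * (a1 * c2 - c1 * a2)"
    using assms(1-4) by linarith+
  \<comment> \<open>The terms with \<open>l1\<close>, \<open>l2\<close> and with undifferentiated
    \<open>h\<close> cancel, and \<open>\<kappa>\<close> comes from \<open>l21\<close>. The
    coefficient 4 is 1 + 2 + 1: one part from \<open>\<nu>1\<close> and \<open>\<nu>2\<close>, two
    from \<open>n21\<close>, and one from \<open>q1\<close> and \<open>q2\<close> once
    \<open>\<nu> * n1\<close> and \<open>\<nu> * n2\<close> are replaced.\<close>
  show "h1 * a2 - h2 * a1 = - (\<kappa> - 4 * \<mu>\<^sup>2) * (a1 * c2 - c1 * a2) * q"
    using n assms(13) unfolding a21 c21 n21 l21 \<nu> p q power2_eq_square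
    by algebra
  show "h1 * c2 - h2 * c1 = (\<kappa> - 4 * \<mu>\<^sup>2) * (a1 * c2 - c1 * a2) * p"
    using n assms(14) unfolding a21 c21 n21 l21 \<nu> p q power2_eq_square
    by algebra
qed

lemma functional_kernel:
  assumes "linear (l :: real^2 \<Rightarrow> real)"
  obtains v where "v \<noteq> 0" "l v = 0"
proof (cases "l (axis 1 1) = 0")
  case True
  then show thesis using that[of "axis 1 1"] by simp
next
  case False
  let ?v = "l (axis 2 1) *\<^sub>R axis 1 1 - l (axis 1 1) *\<^sub>R (axis 2 1 :: real^2)"
  have "?v $ 2 \<noteq> 0" using False by (simp add: axis_eq_axis axis_nth) (simp add: axis_def)
  then have "?v \<noteq> 0" by (metis zero_index)
  moreover have "l ?v = 0" using linear_diff[OF assms] linear_cmul[OF assms] by simp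
  ultimately show thesis using that by blast
qed

locale umbilic_surface = unit_fibration G U g V p \<xi> \<kappa> \<tau>
  for G U g V p \<xi> \<kappa> \<tau> +
  fixes F N :: "real^2 \<Rightarrow> real^3" and W :: "(real^2) set" and h :: "real^2 \<Rightarrow> real"
    and b1 b2 :: "real^2 \<Rightarrow> real^2"
  assumes W_open: "open W" and F_smooth: "smooth_on W F" and F_maps: "F ` W \<subseteq> U"
    and F_immersion: "u \<in> W \<Longrightarrow> inj (Der F u)"
    and N_smooth: "smooth_on W N"
    and N_unit: "u \<in> W \<Longrightarrow> ip (G (F u)) (N u) (N u) = 1"
    and N_normal: "u \<in> W \<Longrightarrow> ip (G (F u)) (N u) (Der F u v) = 0"
    and umbilic: "u \<in> W \<Longrightarrow> cov_along G F N u v = - h u *\<^sub>R Der F u v"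
    and b1_smooth: "smooth_on W b1" and b2_smooth: "smooth_on W b2"
    and frame: "u \<in> W \<Longrightarrow> orthonormal (g (p (F u))) (b1 u) (b2 u)"
    and tau_nonzero: "\<tau> \<noteq> 0" and kappa_tau: "\<kappa> - 4 * \<tau>\<^sup>2 \<noteq> 0"
begin

text \<open>The tangent vector of the surface in the direction \<open>v\<close> has horizontal components \<open>x1 v\<close>,
  \<open>x2 v\<close> with respect to the frame and vertical component \<open>n v\<close>; the unit normal has the
  components \<open>v1\<close>, \<open>v2\<close> and \<open>\<nu>\<close>.  The function \<open>\<mu>\<close> is \<open>\<tau>\<close> or \<open>- \<tau>\<close>, depending on the orientation of
  the frame.\<close>

definition f where "f u = p (F u)"
definition \<nu> where "\<nu> u = \<eta> (F u) (N u)"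
definition n where "n v u = \<eta> (F u) (Der F u v)"
definition x1 where "x1 v u = ip (g (f u)) (Der f u v) (b1 u)"
definition x2 where "x2 v u = ip (g (f u)) (Der f u v) (b2 u)"
definition PN where "PN u = Der p (F u) (N u)"
definition v1 where "v1 u = ip (g (f u)) (PN u) (b1 u)"
definition v2 where "v2 u = ip (g (f u)) (PN u) (b2 u)"
text \<open>The connection form of the frame along \<open>f\<close>. It carries the curvature of the
  base into the computation.\<close>

definition \<alpha> where "\<alpha> v u = ip (g (f u)) (cov_along g f b1 u v) (b2 u)"
definition \<mu> where "\<mu> u = - \<Omega> (F u) (inv (Der p (F u)) (b1 u)) (inv (Der p (F u)) (b2 u))"

lemma FU: "u \<in> W \<Longrightarrow> F u \<in> U"
  using F_maps by blast

lemma fV: "u \<in> W \<Longrightarrow> f u \<in> V"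
  using p_maps FU by (auto simp: f_def)

lemma f_smooth: "smooth_on W f"
  unfolding f_def[abs_def] by (rule smooth_on_compose[OF tot.open_dom W_open F_maps F_smooth p_smooth])

lemma f_maps: "f ` W \<subseteq> V"
  using fV by blast

lemma Der_f: "u \<in> W \<Longrightarrow> Der f u v = Der p (F u) (Der F u v)"
  unfolding f_def[abs_def]
  by (rule Der_compose[OF smooth_on_differentiable[OF F_smooth] smooth_on_differentiable[OF p_smooth FU]])

lemma PN_smooth: "smooth_on W PN"
  unfolding PN_def[abs_def]
  by (rule smooth_on_Der_along[OF tot.open_dom W_open F_maps F_smooth p_smooth N_smooth])

lemma gf_smooth: "smooth_on W (\<lambda>u. g (f u))"
  by (rule smooth_on_compose[OF base.open_dom W_open f_maps f_smooth base.smooth_gram])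

lemma GF_smooth: "smooth_on W (\<lambda>u. G (F u))"
  by (rule smooth_on_compose[OF tot.open_dom W_open F_maps F_smooth tot.smooth_gram])

lemma xiF_smooth: "smooth_on W (\<lambda>u. \<xi> (F u))"
  by (rule smooth_on_compose[OF tot.open_dom W_open F_maps F_smooth xi_smooth])

lemma nu_smooth: "smooth_on W \<nu>"
  unfolding \<nu>_def[abs_def] \<eta>_def by (intro smooth_on_ip W_open GF_smooth xiF_smooth N_smooth)

lemma n_smooth: "smooth_on W (n v)"
  unfolding n_def[abs_def] \<eta>_def by (intro smooth_on_ip W_open GF_smooth xiF_smooth smooth_on_Der F_smooth)

lemma x1_smooth: "smooth_on W (x1 v)" and x2_smooth: "smooth_on W (x2 v)"
  unfolding x1_def[abs_def] x2_def[abs_def]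
  by (intro smooth_on_ip W_open gf_smooth smooth_on_Der f_smooth b1_smooth b2_smooth)+

lemma v1_smooth: "smooth_on W v1" and v2_smooth: "smooth_on W v2"
  unfolding v1_def[abs_def] v2_def[abs_def]
  by (intro smooth_on_ip W_open gf_smooth PN_smooth b1_smooth b2_smooth)+

lemma alpha_smooth: "smooth_on W (\<alpha> v)"
  unfolding \<alpha>_def[abs_def]
  by (intro smooth_on_ip W_open gf_smooth base.smooth_cov_along f_maps f_smooth b1_smooth b2_smooth)

text \<open>\<open>h\<close> is given only pointwise, as the factor in \<open>umbilic\<close>.
  Pairing that identity with a nonzero tangent vector exhibits it as a quotient of smooth functions,
  so that its second derivatives may be used.\<close>

lemma h_smooth: "smooth_on W h"
proof -
  let ?D = "\<lambda>u. Der F u (axis 1 1)"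
  have nz: "ip (G (F u)) (?D u) (?D u) \<noteq> 0" if "u \<in> W" for u
  proof -
    have "?D u \<noteq> Der F u 0" using F_immersion[OF that] by (simp add: inj_eq)
    then have "?D u \<noteq> 0" using linear_0[OF smooth_on_linear_Der[OF F_smooth that]] by simp
    then show ?thesis using tot.gram_pos[OF FU[OF that]] by fastforce
  qed
  show ?thesis
  proof (rule smooth_on_cong[OF W_open])
    show "smooth_on W (\<lambda>u. - (ip (G (F u)) (cov_along G F N u (axis 1 1)) (?D u) / ip (G (F u)) (?D u) (?D u)))"
      by (intro smooth_on_minus smooth_on_divide smooth_on_ip W_open GF_smooth tot.smooth_cov_along
          F_maps F_smooth N_smooth smooth_on_Der nz)
    show "- (ip (G (F u)) (cov_along G F N u (axis 1 1)) (?D u) / ip (G (F u)) (?D u) (?D u)) = h u"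
      if "u \<in> W" for u
      using umbilic[OF that, of "axis 1 1"] nz[OF that] by (simp add: ip_simps)
  qed
qed

lemma n_linear: "u \<in> W \<Longrightarrow> linear (\<lambda>v. n v u)"
  and x1_linear: "u \<in> W \<Longrightarrow> linear (\<lambda>v. x1 v u)"
  and x2_linear: "u \<in> W \<Longrightarrow> linear (\<lambda>v. x2 v u)"
  using smooth_on_linear_Der[OF F_smooth, of u] smooth_on_linear_Der[OF f_smooth, of u]
  by (auto simp: linear_iff n_def x1_def x2_def \<eta>_def ip_simps)

lemma frame_lift:
  assumes "u \<in> W"
  shows "Der p (F u) (inv (Der p (F u)) y) = y"
  using p_surj[OF FU[OF assms]] by (simp add: surj_f_inv_f)

text \<open>The preimages selected by \<open>inv\<close> in \<open>\<mu>\<close> are arbitrary,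
  neither horizontal nor smooth in general; this is harmless because \<open>Omega_base\<close> holds
  for any lifts of the frame.\<close>

lemma Omega_mu:
  assumes u: "u \<in> W"
  shows "\<Omega> (F u) x y = - \<mu> u *
    (ip (g (f u)) (Der p (F u) x) (b1 u) * ip (g (f u)) (Der p (F u) y) (b2 u)
     - ip (g (f u)) (Der p (F u) x) (b2 u) * ip (g (f u)) (Der p (F u) y) (b1 u))"
  using Omega_base[OF FU[OF u], of "inv (Der p (F u)) (b1 u)" "inv (Der p (F u)) (b2 u)" x y]
    frame[OF u] frame_lift[OF u] by (simp add: \<mu>_def f_def)

lemma mu_square: "u \<in> W \<Longrightarrow> (\<mu> u)\<^sup>2 = \<tau>\<^sup>2"
  using Omega_orthonormal[OF FU, of u "inv (Der p (F u)) (b1 u)" "inv (Der p (F u)) (b2 u)"]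
    frame[of u] frame_lift[of u] by (simp add: \<mu>_def)

lemma mu_nonzero: "u \<in> W \<Longrightarrow> \<mu> u \<noteq> 0"
  using mu_square[of u] tau_nonzero by auto

section \<open>Structure equations for the pulled-back components\<close>

lemma Der_nu:
  assumes u: "u \<in> W"
  shows "Der \<nu> u v = - h u * n v u - \<mu> u * (x1 v u * v2 u - x2 v u * v1 u)"
proof -
  have dF: "F differentiable (at u)" and dN: "N differentiable (at u)" and dxi: "\<xi> differentiable (at (F u))"
    and dxiF: "(\<lambda>u. \<xi> (F u)) differentiable (at u)"
    using smooth_on_differentiable F_smooth N_smooth xi_smooth xiF_smooth u FU by blast+
  have "Der \<nu> u v = ip (G (F u)) (cov_along G F N u v) (\<xi> (F u)) +
      ip (G (F u)) (N u) (cov_along G F (\<lambda>u. \<xi> (F u)) u v)"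
    using tot.ip_cov_along[OF FU[OF u] dF dN dxiF] by (simp add: \<nu>_def[abs_def] \<eta>_def)
  \<comment> \<open>Umbilicity evaluates the derivative of \<open>N\<close>; the derivative of
    \<open>\<xi>\<close> along the surface is what \<open>\<Omega>\<close> records.\<close>
  also have "\<dots> = - h u * n v u + \<Omega> (F u) (Der F u v) (N u)"
    by (simp add: umbilic[OF u] cov_along_field[OF dF dxi] ip_simps n_def \<eta>_def \<Omega>_def
        tot.gram_commute[OF FU[OF u], of "N u"])
  finally show ?thesis
    by (simp add: Omega_mu[OF u] x1_def x2_def v1_def v2_def PN_def Der_f[OF u])
qed

text \<open>The contribution of the second derivatives of \<open>F\<close> is symmetric in
  \<open>v\<close> and \<open>w\<close> and drops out. Left over is twice \<open>\<Omega>\<close> on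
  the tangent plane, the pulled-back exterior derivative of \<open>\<eta>\<close>.\<close>

lemma Der_n_skew:
  assumes u: "u \<in> W"
  shows "Der (n w) u v - Der (n v) u w = - 2 * \<mu> u * (x1 v u * x2 w u - x2 v u * x1 w u)"
proof -
  have dF: "F differentiable (at u)" and dxi: "\<xi> differentiable (at (F u))"
    and dxiF: "(\<lambda>u. \<xi> (F u)) differentiable (at u)" and dDF: "(\<lambda>u. Der F u w) differentiable (at u)" for w
    using smooth_on_differentiable F_smooth smooth_on_Der xi_smooth xiF_smooth u FU by blast+
  have "Der (n w) u v = ip (G (F u)) (cov_along G F (\<lambda>u. Der F u w) u v) (\<xi> (F u)) + \<Omega> (F u) (Der F u v) (Der F u w)"
    for v w
    using tot.ip_cov_along[OF FU[OF u] dF dDF dxiF]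
    by (simp add: n_def[abs_def] \<eta>_def cov_along_field[OF dF dxi] \<Omega>_def
        tot.gram_commute[OF FU[OF u], of "Der F u w"])
  then have "Der (n w) u v - Der (n v) u w = \<Omega> (F u) (Der F u v) (Der F u w) - \<Omega> (F u) (Der F u w) (Der F u v)"
    using tot.cov_along_commute[OF W_open F_maps F_smooth u, of w v] by simp
  then show ?thesis
    by (simp add: Omega_mu[OF u] x1_def x2_def Der_f[OF u] algebra_simps)
qed

text \<open>The three inner products of the frame are constant; differentiating them shows that the
  frame can only rotate, with speed \<open>\<alpha>\<close>.\<close>

lemma cov_b:
  assumes u: "u \<in> W"
  shows "ip (g (f u)) (cov_along g f b1 u v) y = \<alpha> v u * ip (g (f u)) y (b2 u)"
    and "ip (g (f u)) (cov_along g f b2 u v) y = - \<alpha> v u * ip (g (f u)) y (b1 u)"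
proof -
  have df: "f differentiable (at u)" and d1: "b1 differentiable (at u)" and d2: "b2 differentiable (at u)"
    using smooth_on_differentiable f_smooth b1_smooth b2_smooth u by blast+
  have sym: "transpose (g (f u)) = g (f u)" by (rule base.gram_sym[OF fV[OF u]])
  have const: "Der (\<lambda>u. ip (g (f u)) (a u) (b u)) u v = 0"
    if "\<And>u. u \<in> W \<Longrightarrow> ip (g (f u)) (a u) (b u) = c" for a b c
    using fun_cong[OF Der_cong[OF W_open u, of "\<lambda>_. c" "\<lambda>u. ip (g (f u)) (a u) (b u)"], of v] that by simp
  note o = frame[unfolded orthonormal_def, folded f_def]
  have 1: "ip (g (f u)) (cov_along g f b1 u v) (b1 u) = 0" "ip (g (f u)) (cov_along g f b2 u v) (b2 u) = 0"
    "ip (g (f u)) (cov_along g f b2 u v) (b1 u) = - \<alpha> v u"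
    using base.ip_cov_along[OF fV[OF u] df d1 d1, of v] base.ip_cov_along[OF fV[OF u] df d2 d2, of v]
      base.ip_cov_along[OF fV[OF u] df d1 d2, of v]
      const[of b1 b1 1] const[of b2 b2 1] const[of b1 b2 0] o
      ip_commute[OF sym, of "b1 u"] ip_commute[OF sym, of "b2 u" "cov_along g f b2 u v"]
    by (auto simp: \<alpha>_def)
  show "ip (g (f u)) (cov_along g f b1 u v) y = \<alpha> v u * ip (g (f u)) y (b2 u)"
    "ip (g (f u)) (cov_along g f b2 u v) y = - \<alpha> v u * ip (g (f u)) y (b1 u)"
    using orthonormal_ip[OF sym frame[OF u, folded f_def], of _ y] 1 by (simp_all add: \<alpha>_def)
qed

lemma Der_components:
  assumes u: "u \<in> W" and dY: "Y differentiable (at u)"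
  shows "Der (\<lambda>u. ip (g (f u)) (Y u) (b1 u)) u v =
      ip (g (f u)) (cov_along g f Y u v) (b1 u) + \<alpha> v u * ip (g (f u)) (Y u) (b2 u)"
    and "Der (\<lambda>u. ip (g (f u)) (Y u) (b2 u)) u v =
      ip (g (f u)) (cov_along g f Y u v) (b2 u) - \<alpha> v u * ip (g (f u)) (Y u) (b1 u)"
proof -
  have df: "f differentiable (at u)" and d1: "b1 differentiable (at u)" and d2: "b2 differentiable (at u)"
    using smooth_on_differentiable f_smooth b1_smooth b2_smooth u by blast+
  show "Der (\<lambda>u. ip (g (f u)) (Y u) (b1 u)) u v =
      ip (g (f u)) (cov_along g f Y u v) (b1 u) + \<alpha> v u * ip (g (f u)) (Y u) (b2 u)"
    "Der (\<lambda>u. ip (g (f u)) (Y u) (b2 u)) u v =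
      ip (g (f u)) (cov_along g f Y u v) (b2 u) - \<alpha> v u * ip (g (f u)) (Y u) (b1 u)"
    unfolding base.ip_cov_along[OF fV[OF u] df dY d1] base.ip_cov_along[OF fV[OF u] df dY d2]
      base.gram_commute[OF fV[OF u], of "Y u" "cov_along g f _ u v"] cov_b[OF u] by simp_all
qed

text \<open>The terms with \<open>h\<close> come from umbilicity, those with \<open>\<mu>\<close>
  are the corrections of \<open>cov_along_project\<close> applied to \<open>N\<close>, and those
  with \<open>\<alpha>\<close> come from the rotation of the frame.\<close>

lemma Der_v:
  assumes u: "u \<in> W"
  shows "Der v1 u v = - h u * x1 v u - \<nu> u * \<mu> u * x2 v u - n v u * \<mu> u * v2 u + \<alpha> v u * v2 u"
    and "Der v2 u v = - h u * x2 v u + \<nu> u * \<mu> u * x1 v u + n v u * \<mu> u * v1 u - \<alpha> v u * v1 u"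
proof -
  have dF: "F differentiable (at u)" and dN: "N differentiable (at u)" and dP: "PN differentiable (at u)"
    using smooth_on_differentiable F_smooth N_smooth PN_smooth u by blast+
  have lin: "linear (Der p (F u))" by (rule p_linear[OF FU[OF u]])
  have "ip (g (f u)) (cov_along g f PN u v) (Der p (F u) z) =
     - h u * ip (g (f u)) (Der f u v) (Der p (F u) z) - \<nu> u * \<Omega> (F u) (Der F u v) z - n v u * \<Omega> (F u) (N u) z" for z
    using cov_along_project[OF FU[OF u] dF dN, of v z]
    by (simp add: f_def[abs_def, symmetric] f_def[symmetric] PN_def[abs_def, symmetric] umbilic[OF u]
        linear_cmul[OF lin] linear_neg[OF lin] Der_f[OF u] ip_simps \<nu>_def n_def)
  then have *: "ip (g (f u)) (cov_along g f PN u v) y =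
     - h u * ip (g (f u)) (Der f u v) y - \<nu> u * \<Omega> (F u) (Der F u v) (inv (Der p (F u)) y)
     - n v u * \<Omega> (F u) (N u) (inv (Der p (F u)) y)" for y
    using frame_lift[OF u] by metis
  have o: "ip (g (f u)) (b1 u) (b1 u) = 1" "ip (g (f u)) (b2 u) (b2 u) = 1"
    "ip (g (f u)) (b1 u) (b2 u) = 0" "ip (g (f u)) (b2 u) (b1 u) = 0"
    using frame[OF u] base.gram_commute[OF fV[OF u], of "b1 u" "b2 u"]
    by (auto simp: orthonormal_def f_def)
  show "Der v1 u v = - h u * x1 v u - \<nu> u * \<mu> u * x2 v u - n v u * \<mu> u * v2 u + \<alpha> v u * v2 u"
    using Der_components(1)[OF u dP, of v]
    by (simp add: * v1_def[abs_def] Omega_mu[OF u] frame_lift[OF u] o x1_def x2_def v2_def Der_f[OF u] PN_def)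
  show "Der v2 u v = - h u * x2 v u + \<nu> u * \<mu> u * x1 v u + n v u * \<mu> u * v1 u - \<alpha> v u * v1 u"
    using Der_components(2)[OF u dP, of v]
    by (simp add: * v2_def[abs_def] Omega_mu[OF u] frame_lift[OF u] o x1_def x2_def v1_def Der_f[OF u] PN_def)
qed

text \<open>Cartan's first structure equation for the coframe \<open>x1\<close>, \<open>x2\<close>:
  the base connection has no torsion.\<close>

lemma Der_x_skew:
  assumes u: "u \<in> W"
  shows "Der (x1 w) u v - \<alpha> v u * x2 w u = Der (x1 v) u w - \<alpha> w u * x2 v u"
    and "Der (x2 w) u v + \<alpha> v u * x1 w u = Der (x2 v) u w + \<alpha> w u * x1 v u"
proof -
  have d: "(\<lambda>u. Der f u w) differentiable (at u)" for w
    using smooth_on_differentiable f_smooth smooth_on_Der u by blast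
  note c = base.cov_along_commute[OF W_open f_maps f_smooth u, of w v]
  show "Der (x1 w) u v - \<alpha> v u * x2 w u = Der (x1 v) u w - \<alpha> w u * x2 v u"
    using c Der_components(1)[OF u d] by (simp add: x1_def[abs_def] x2_def)
  show "Der (x2 w) u v + \<alpha> v u * x1 w u = Der (x2 v) u w + \<alpha> w u * x1 v u"
    using c Der_components(2)[OF u d] by (simp add: x2_def[abs_def] x1_def)
qed

lemma frame_ip:
  "u \<in> W \<Longrightarrow> ip (g (f u)) x y =
    ip (g (f u)) x (b1 u) * ip (g (f u)) y (b1 u) + ip (g (f u)) x (b2 u) * ip (g (f u)) y (b2 u)"
  by (rule orthonormal_ip[OF base.gram_sym[OF fV] frame[folded f_def]])

lemma normal_components:
  assumes u: "u \<in> W"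
  shows "\<nu> u * n v u = - (v1 u * x1 v u + v2 u * x2 v u)"
    and "(v1 u)\<^sup>2 + (v2 u)\<^sup>2 + (\<nu> u)\<^sup>2 = 1"
proof -
  have "ip (g (f u)) (PN u) (Der f u v) = - \<nu> u * n v u"
    using ip_base[OF FU[OF u], of "N u" "Der F u v"] N_normal[OF u, of v]
    by (simp add: PN_def f_def[symmetric] Der_f[OF u] \<nu>_def n_def)
  then show "\<nu> u * n v u = - (v1 u * x1 v u + v2 u * x2 v u)"
    using frame_ip[OF u, of "PN u" "Der f u v"] by (simp add: v1_def v2_def x1_def x2_def)
  have "ip (g (f u)) (PN u) (PN u) = 1 - (\<nu> u)\<^sup>2"
    using ip_base[OF FU[OF u], of "N u" "N u"] N_unit[OF u]
    by (simp add: PN_def f_def[symmetric] \<nu>_def power2_eq_square)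
  then show "(v1 u)\<^sup>2 + (v2 u)\<^sup>2 + (\<nu> u)\<^sup>2 = 1"
    using frame_ip[OF u, of "PN u" "PN u"] by (simp add: v1_def v2_def power2_eq_square)
qed

text \<open>By \<open>ip_base\<close> the three components determine the length of
  \<open>Der F u v\<close>, and \<open>Der F u\<close> is injective.\<close>

lemma tangent_zero:
  assumes u: "u \<in> W" and "x1 v u = 0" "x2 v u = 0" "n v u = 0"
  shows "v = 0"
proof -
  have "ip (g (f u)) (Der f u v) (Der f u v) = 0"
    using frame_ip[OF u, of "Der f u v" "Der f u v"] assms by (simp add: x1_def x2_def)
  then have "ip (G (F u)) (Der F u v) (Der F u v) = 0"
    using ip_base[OF FU[OF u], of "Der F u v" "Der F u v"] assms(4)
    by (simp add: n_def Der_f[OF u] f_def[symmetric])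
  then have "Der F u v = 0"
    using tot.gram_pos[OF FU[OF u], of "Der F u v"] by fastforce
  then have "Der F u v = Der F u 0"
    using linear_0[OF smooth_on_linear_Der[OF F_smooth u]] by simp
  then show ?thesis using F_immersion[OF u] by (simp add: inj_eq)
qed

text \<open>Cartan's second structure equation. The minus sign arises because
  \<open>base_curvature\<close> pairs the curvature of two vectors applied to the second with the
  first, whereas here \<open>b1 u\<close> is the argument and \<open>b2 u\<close> the test
  vector.\<close>

lemma Der_alpha_skew:
  assumes u: "u \<in> W"
  shows "Der (\<alpha> w) u v - Der (\<alpha> v) u w = - \<kappa> * (x1 v u * x2 w u - x2 v u * x1 w u)"
proof -
  let ?g = "g (f u)"
  let ?K = "\<lambda>x y. ip ?g (curvature g (f u) x y (b1 u)) (b2 u)"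
  have df: "f differentiable (at u)" and d2: "b2 differentiable (at u)"
    and dc: "(\<lambda>u. cov_along g f b1 u w) differentiable (at u)" for w
    using smooth_on_differentiable f_smooth b2_smooth u
      base.smooth_cov_along[OF W_open f_maps f_smooth b1_smooth] by blast+
  have sym: "transpose ?g = ?g" by (rule base.gram_sym[OF fV[OF u]])
  have o: "ip ?g (b1 u) (b1 u) = 1" "ip ?g (b2 u) (b2 u) = 1" "ip ?g (b1 u) (b2 u) = 0" "ip ?g (b2 u) (b1 u) = 0"
    using frame[OF u] ip_commute[OF sym, of "b1 u" "b2 u"] by (auto simp: orthonormal_def f_def)
  have "Der (\<alpha> w) u v = ip ?g (cov_along g f (\<lambda>u. cov_along g f b1 u w) u v) (b2 u)" for v w
  proof -
    \<comment> \<open>The derivatives of \<open>b1\<close> and \<open>b2\<close> are multiples of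
      \<open>b2\<close> and \<open>b1\<close>, so the product of first derivatives
      disappears.\<close>
    have "ip ?g (cov_along g f b1 u w) (cov_along g f b2 u v) = 0"
      by (simp add: cov_b[OF u] o)
    then show ?thesis
      using base.ip_cov_along[OF fV[OF u] df dc d2, of w v] by (simp add: \<alpha>_def[abs_def])
  qed
  then have "Der (\<alpha> w) u v - Der (\<alpha> v) u w = ?K (Der f u v) (Der f u w)"
    using base.cov_along_curvature[OF W_open f_maps f_smooth b1_smooth u, of w v]
    by (simp add: ip_diff_left[symmetric])
  also have "\<dots> = ?K (x1 v u *\<^sub>R b1 u + x2 v u *\<^sub>R b2 u) (x1 w u *\<^sub>R b1 u + x2 w u *\<^sub>R b2 u)"
    using orthonormal_expand[OF sym frame[OF u, folded f_def]] by (simp add: x1_def x2_def)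
  also have "\<dots> = (x1 v u * x2 w u - x2 v u * x1 w u) * ?K (b1 u) (b2 u)"
  proof (rule skew_form_frame)
    show "linear (\<lambda>x. ?K x y)" for y
      using base.curvature_linear[OF fV[OF u], of y "b1 u"] by (simp add: linear_iff ip_simps)
    show "?K x y = - ?K y x" for x y
      using curvature_skew[of g "f u" x y] by (simp add: ip_simps)
  qed
  also have "?K (b1 u) (b2 u) = - \<kappa>"
    using base_curvature[OF fV[OF u], of "b2 u" "b1 u"] curvature_skew[of g "f u" "b1 u" "b2 u"]
    by (simp add: o ip_simps)
  finally show ?thesis by simp
qed

section \<open>Nondegeneracy of the projection and the locus where \<open>\<nu>\<close>
  vanishes\<close>

abbreviation (input) e1 where "e1 \<equiv> axis 1 1 :: real^2"
abbreviation (input) e2 where "e2 \<equiv> axis 2 1 :: real^2"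

text \<open>The determinant of \<open>Der f u\<close> in the frame, that is, the signed area of the
  projected coordinate parallelogram.\<close>

definition \<omega> where "\<omega> u = x1 e1 u * x2 e2 u - x2 e1 u * x1 e2 u"

text \<open>A degenerate projection would give a nonzero tangent vector without horizontal
  components. Orthogonality to \<open>N\<close> then reads \<open>\<nu> u * n v u = 0\<close>, so
  its vertical component would vanish as well.\<close>

lemma area_nonzero:
  assumes u: "u \<in> W" and nz: "\<nu> u \<noteq> 0"
  shows "\<omega> u \<noteq> 0"
proof
  assume 0: "\<omega> u = 0"
  have "\<exists>v. v \<noteq> 0 \<and> x1 v u = 0 \<and> x2 v u = 0"
  proof (cases "x1 e1 u = 0 \<and> x1 e2 u = 0")
    case True
    obtain v where v: "v \<noteq> 0" "x2 v u = 0" using functional_kernel[OF x2_linear[OF u]] .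
    have "v = v $ 1 *\<^sub>R e1 + v $ 2 *\<^sub>R e2" by (simp add: vec_eq_iff forall_2 axis_def)
    then have "x1 v u = v $ 1 * x1 e1 u + v $ 2 * x1 e2 u"
      using linear_add[OF x1_linear[OF u]] linear_cmul[OF x1_linear[OF u]] by (metis real_scaleR_def)
    with True v show ?thesis by auto
  next
    case False
    \<comment> \<open>A kernel vector of \<open>x1\<close>, on which \<open>x2\<close> takes the
      value \<open>- \<omega> u\<close>.\<close>
    let ?v = "x1 e2 u *\<^sub>R e1 - x1 e1 u *\<^sub>R e2"
    have "?v $ 1 = x1 e2 u" "?v $ 2 = - x1 e1 u" by (simp_all add: axis_def)
    with False have "?v \<noteq> 0" by (metis neg_0_equal_iff_equal zero_index)
    moreover have "x1 ?v u = 0" "x2 ?v u = 0"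
      using 0
      by (simp_all add: linear_diff[OF x1_linear[OF u]] linear_cmul[OF x1_linear[OF u]]
          linear_diff[OF x2_linear[OF u]] linear_cmul[OF x2_linear[OF u]] \<omega>_def mult.commute)
    ultimately show ?thesis by blast
  qed
  then obtain v where "v \<noteq> 0" "x1 v u = 0" "x2 v u = 0" by blast
  then show False using tangent_zero[OF u, of v] normal_components(1)[OF u, of v] nz by simp
qed

lemma nu_not_vanishing:
  assumes "W \<noteq> {}"
  obtains u where "u \<in> W" "\<nu> u \<noteq> 0"
proof (rule ccontr)
  assume "\<not> thesis"
  then have zero: "\<nu> u = 0" if "u \<in> W" for u using that \<open>\<And>u. u \<in> W \<Longrightarrow> \<nu> u \<noteq> 0 \<Longrightarrow> thesis\<close> by blast
  obtain u where u: "u \<in> W" using assms by blast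
  \<comment> \<open>A horizontal tangent direction, chosen so that the unknown \<open>h u\<close>
    drops out of \<open>Der_nu\<close>.\<close>
  obtain v where v: "v \<noteq> 0" "n v u = 0" using functional_kernel[OF n_linear[OF u]] .
  have "Der \<nu> u v = 0"
    using fun_cong[OF Der_cong[OF W_open u, of "\<lambda>_. 0" \<nu>], of v] zero by simp
  then have t: "x1 v u * v2 u - x2 v u * v1 u = 0"
    using Der_nu[OF u, of v] v mu_nonzero[OF u] by simp
  have o: "v1 u * x1 v u + v2 u * x2 v u = 0" and l: "(v1 u)\<^sup>2 + (v2 u)\<^sup>2 = 1"
    using normal_components(1)[OF u, of v] normal_components(2)[OF u] zero[OF u] by auto
  \<comment> \<open>By \<open>t\<close> and \<open>o\<close> the pair \<open>x1 v u\<close>,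
    \<open>x2 v u\<close> is both parallel and orthogonal to the unit vector with components
    \<open>v1 u\<close>, \<open>v2 u\<close>, hence zero.\<close>
  have "x1 v u = ((v1 u)\<^sup>2 + (v2 u)\<^sup>2) * x1 v u" "x2 v u = ((v1 u)\<^sup>2 + (v2 u)\<^sup>2) * x2 v u"
    by (simp_all add: l)
  moreover have "((v1 u)\<^sup>2 + (v2 u)\<^sup>2) * x1 v u = 0" "((v1 u)\<^sup>2 + (v2 u)\<^sup>2) * x2 v u = 0"
    using t o by algebra+
  ultimately show False using tangent_zero[OF u, of v] v by simp
qed

text \<open>The points whose tangent plane does not contain \<open>\<xi>\<close>. The set is open,
  so equations established on it can be differentiated again.\<close>

definition W\<^sub>0 where "W\<^sub>0 = {u \<in> W. \<nu> u \<noteq> 0}"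

lemma W0_open: "open W\<^sub>0"
proof -
  have "open (W \<inter> \<nu> -` (- {0}))"
    by (rule continuous_open_preimage[OF smooth_on_continuous[OF nu_smooth] W_open]) auto
  moreover have "W\<^sub>0 = W \<inter> \<nu> -` (- {0})" by (auto simp: W\<^sub>0_def)
  ultimately show ?thesis by simp
qed

lemma W0_W: "u \<in> W\<^sub>0 \<Longrightarrow> u \<in> W" and W0_subset: "W\<^sub>0 \<subseteq> W" and W0_nu: "u \<in> W\<^sub>0 \<Longrightarrow> \<nu> u \<noteq> 0"
  by (auto simp: W\<^sub>0_def)

text \<open>Only \<open>\<mu>\<^sup>2\<close> is known to be constant; that \<open>\<mu>\<close> is differentiable at all is read off the exterior
  derivative of \<open>n\<close>, which is where \<open>\<nu> \<noteq> 0\<close> enters.\<close>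

lemma mu_has_derivative:
  assumes u: "u \<in> W\<^sub>0"
  shows "(\<mu> has_derivative (\<lambda>_. 0)) (at u)"
proof -
  let ?r = "\<lambda>u. - (Der (n e2) u e1 - Der (n e1) u e2) / (2 * \<omega> u)"
  have "smooth_on W\<^sub>0 ?r"
    using area_nonzero W0_W W0_nu unfolding \<omega>_def
    by (intro smooth_on_divide smooth_on_minus smooth_on_diff smooth_on_Der smooth_on_mult smooth_on_const W0_open
        smooth_on_subset[OF n_smooth W0_subset] smooth_on_subset[OF x1_smooth W0_subset]
        smooth_on_subset[OF x2_smooth W0_subset]) (auto simp: \<omega>_def)
  then have "smooth_on W\<^sub>0 \<mu>"
    by (rule smooth_on_cong[OF W0_open, rotated])
      (use Der_n_skew[OF W0_W, of _ e2 e1, folded \<omega>_def] area_nonzero W0_W W0_nu in simp)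
  then have d: "(\<mu> has_derivative Der \<mu> u) (at u)" using smooth_on_has_derivative u by blast
  have "((\<lambda>u. \<mu> u * \<mu> u) has_derivative (\<lambda>v. \<mu> u * Der \<mu> u v + Der \<mu> u v * \<mu> u)) (at u)"
    by (rule has_derivative_mult[OF d d])
  moreover have "((\<lambda>u. \<mu> u * \<mu> u) has_derivative (\<lambda>_. 0)) (at u)"
    by (rule has_derivative_transform_within_open[OF has_derivative_const[of "\<tau>\<^sup>2"] W0_open u])
      (use mu_square W0_W in \<open>simp add: power2_eq_square\<close>)
  ultimately have "(\<lambda>v. \<mu> u * Der \<mu> u v + Der \<mu> u v * \<mu> u) = (\<lambda>_. 0)"
    by (rule has_derivative_unique)
  then have "Der \<mu> u = (\<lambda>_. 0)"
    using mu_nonzero[OF W0_W[OF u]] by (auto simp: fun_eq_iff)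
  with d show ?thesis by simp
qed

text \<open>Codazzi's equation, obtained from the symmetry of the second derivatives of \<open>v1\<close> and \<open>v2\<close>.\<close>

lemma Der_h:
  assumes u: "u \<in> W\<^sub>0"
  shows "Der h u e1 = - (\<kappa> - 4 * \<tau>\<^sup>2) * \<nu> u * n e1 u" and "Der h u e2 = - (\<kappa> - 4 * \<tau>\<^sup>2) * \<nu> u * n e2 u"
proof -
  have uW: "u \<in> W" using W0_W[OF u] .
  have d: "(k has_derivative Der k u) (at u)" if "smooth_on W k" for k :: "real^2 \<Rightarrow> real"
    using smooth_on_has_derivative[OF that uW] .
  \<comment> \<open>The last fact lets \<open>\<mu>\<close> be treated as a constant, so no
    derivative of it appears below.\<close>
  note ds = d[OF h_smooth] d[OF nu_smooth] d[OF n_smooth] d[OF x1_smooth] d[OF x2_smooth] d[OF v1_smooth]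
    d[OF v2_smooth] d[OF alpha_smooth] mu_has_derivative[OF u]
  have r1: "((\<lambda>u. - h u * x1 w u - \<nu> u * \<mu> u * x2 w u - n w u * \<mu> u * v2 u + \<alpha> w u * v2 u) has_derivative
    (\<lambda>v. - (Der h u v * x1 w u + h u * Der (x1 w) u v) - \<mu> u * (Der \<nu> u v * x2 w u + \<nu> u * Der (x2 w) u v)
      - \<mu> u * (Der (n w) u v * v2 u + n w u * Der v2 u v) + (Der (\<alpha> w) u v * v2 u + \<alpha> w u * Der v2 u v))) (at u)" for w
    by (rule has_derivative_eq_rhs, (rule derivative_intros ds)+) (simp add: fun_eq_iff algebra_simps)
  have r2: "((\<lambda>u. - h u * x2 w u + \<nu> u * \<mu> u * x1 w u + n w u * \<mu> u * v1 u - \<alpha> w u * v1 u) has_derivative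
    (\<lambda>v. - (Der h u v * x2 w u + h u * Der (x2 w) u v) + \<mu> u * (Der \<nu> u v * x1 w u + \<nu> u * Der (x1 w) u v)
      + \<mu> u * (Der (n w) u v * v1 u + n w u * Der v1 u v) - (Der (\<alpha> w) u v * v1 u + \<alpha> w u * Der v1 u v))) (at u)" for w
    by (rule has_derivative_eq_rhs, (rule derivative_intros ds)+) (simp add: fun_eq_iff algebra_simps)
  have s1: "((\<lambda>u. Der v1 u w) has_derivative
    (\<lambda>v. - (Der h u v * x1 w u + h u * Der (x1 w) u v) - \<mu> u * (Der \<nu> u v * x2 w u + \<nu> u * Der (x2 w) u v)
      - \<mu> u * (Der (n w) u v * v2 u + n w u * Der v2 u v) + (Der (\<alpha> w) u v * v2 u + \<alpha> w u * Der v2 u v))) (at u)" for w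
    by (rule has_derivative_transform_within_open[OF r1 W_open uW]) (simp add: Der_v)
  have s2: "((\<lambda>u. Der v2 u w) has_derivative
    (\<lambda>v. - (Der h u v * x2 w u + h u * Der (x2 w) u v) + \<mu> u * (Der \<nu> u v * x1 w u + \<nu> u * Der (x1 w) u v)
      + \<mu> u * (Der (n w) u v * v1 u + n w u * Der v1 u v) - (Der (\<alpha> w) u v * v1 u + \<alpha> w u * Der v1 u v))) (at u)" for w
    by (rule has_derivative_transform_within_open[OF r2 W_open uW]) (simp add: Der_v)
  note c1 = Der_commute[OF W_open uW v1_smooth, of e2 e1, unfolded Der_eqI[OF s1]]
  note c2 = Der_commute[OF W_open uW v2_smooth, of e2 e1, unfolded Der_eqI[OF s2]]
  note codazzi = codazzi_algebra[OF Der_x_skew(1)[OF uW, of e2 e1] Der_x_skew(2)[OF uW, of e2 e1]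
      Der_n_skew[OF uW, of e2 e1] Der_alpha_skew[OF uW, of e2 e1] Der_nu[OF uW, of e1] Der_nu[OF uW, of e2]
      Der_v(1)[OF uW, of e1] Der_v(1)[OF uW, of e2] Der_v(2)[OF uW, of e1] Der_v(2)[OF uW, of e2]
      normal_components(1)[OF uW, of e1] normal_components(1)[OF uW, of e2] c1 c2,
      folded \<omega>_def, unfolded mu_square[OF uW]]
  note \<nu>n = normal_components(1)[OF uW, of e1] normal_components(1)[OF uW, of e2]
  \<comment> \<open>\<open>codazzi\<close> is a linear system for the two derivatives of
    \<open>h\<close> with determinant \<open>\<omega> u\<close>. Solving it by Cramer's rule
    combines \<open>v1\<close>, \<open>v2\<close> with \<open>x1\<close>, \<open>x2\<close> exactly
    as in \<open>\<nu>n\<close>.\<close>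
  have "\<omega> u * Der h u e1 = \<omega> u * (- (\<kappa> - 4 * \<tau>\<^sup>2) * \<nu> u * n e1 u)"
    using codazzi \<nu>n unfolding \<omega>_def by algebra
  then show "Der h u e1 = - (\<kappa> - 4 * \<tau>\<^sup>2) * \<nu> u * n e1 u"
    using area_nonzero[OF uW W0_nu[OF u]] by simp
  have "\<omega> u * Der h u e2 = \<omega> u * (- (\<kappa> - 4 * \<tau>\<^sup>2) * \<nu> u * n e2 u)"
    using codazzi \<nu>n unfolding \<omega>_def by algebra
  then show "Der h u e2 = - (\<kappa> - 4 * \<tau>\<^sup>2) * \<nu> u * n e2 u"
    using area_nonzero[OF uW W0_nu[OF u]] by simp
qed

lemma nu_constant:
  assumes u: "u \<in> W\<^sub>0"
  shows "3 * (\<nu> u)\<^sup>2 = 1"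
proof -
  have uW: "u \<in> W" using W0_W[OF u] .
  define c where "c = - (\<kappa> - 4 * \<tau>\<^sup>2)"
  have c: "c \<noteq> 0" using kappa_tau by (simp add: c_def)
  have D: "((\<lambda>u. c * \<nu> u * n w u) has_derivative (\<lambda>v. c * (Der \<nu> u v * n w u + \<nu> u * Der (n w) u v))) (at u)" for w
    by (rule has_derivative_eq_rhs,
        (rule derivative_intros smooth_on_has_derivative[OF nu_smooth uW] smooth_on_has_derivative[OF n_smooth uW])+)
      (simp add: fun_eq_iff algebra_simps)
  have D1: "((\<lambda>u. Der h u e1) has_derivative (\<lambda>v. c * (Der \<nu> u v * n e1 u + \<nu> u * Der (n e1) u v))) (at u)"
    by (rule has_derivative_transform_within_open[OF D W0_open u]) (simp add: Der_h c_def)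
  have D2: "((\<lambda>u. Der h u e2) has_derivative (\<lambda>v. c * (Der \<nu> u v * n e2 u + \<nu> u * Der (n e2) u v))) (at u)"
    by (rule has_derivative_transform_within_open[OF D W0_open u]) (simp add: Der_h c_def)
  have "c * (Der \<nu> u e1 * n e2 u + \<nu> u * Der (n e2) u e1) = c * (Der \<nu> u e2 * n e1 u + \<nu> u * Der (n e1) u e2)"
    using Der_commute[OF W_open uW h_smooth, of e2 e1] unfolding Der_eqI[OF D1] Der_eqI[OF D2] .
  then have "Der \<nu> u e1 * n e2 u + \<nu> u * Der (n e2) u e1 = Der \<nu> u e2 * n e1 u + \<nu> u * Der (n e1) u e2"
    using c by simp
  \<comment> \<open>Multiplied by \<open>\<nu> u\<close>, the part with derivatives of
    \<open>\<nu>\<close> becomes \<open>\<mu> u * \<omega> u\<close> times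
    \<open>1 - (\<nu> u)\<^sup>2\<close>, since the terms with \<open>h\<close> cancel; the part
    with derivatives of \<open>n\<close> contributes \<open>- 2 * (\<nu> u)\<^sup>2\<close> times
    the same factor. Hence the 3.\<close>
  then have "\<mu> u * \<omega> u * (3 * (\<nu> u)\<^sup>2 - 1) = 0"
    using Der_nu[OF uW, of e1] Der_nu[OF uW, of e2] Der_n_skew[OF uW, of e2 e1]
      normal_components(1)[OF uW, of e1] normal_components(1)[OF uW, of e2] normal_components(2)[OF uW]
    unfolding \<omega>_def by algebra
  then show ?thesis using mu_nonzero[OF uW] area_nonzero[OF uW W0_nu[OF u]] by simp
qed

text \<open>The locale admits an empty parameter domain, so the contradiction takes this
  form.\<close>

lemma domain_empty: "W = {}"
proof (rule ccontr)
  assume "W \<noteq> {}"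
  then obtain u where uW: "u \<in> W" and nz: "\<nu> u \<noteq> 0" by (rule nu_not_vanishing)
  then have u: "u \<in> W\<^sub>0" by (simp add: W\<^sub>0_def)
  have d: "(\<nu> has_derivative Der \<nu> u) (at u)" by (rule smooth_on_has_derivative[OF nu_smooth uW])
  have "((\<lambda>u. \<nu> u * \<nu> u) has_derivative (\<lambda>v. \<nu> u * Der \<nu> u v + Der \<nu> u v * \<nu> u)) (at u)"
    by (rule has_derivative_mult[OF d d])
  moreover have "((\<lambda>u. \<nu> u * \<nu> u) has_derivative (\<lambda>_. 0)) (at u)"
    by (rule has_derivative_transform_within_open[OF has_derivative_const[of "1 / 3"] W0_open u])
      (use nu_constant in \<open>simp add: power2_eq_square field_simps\<close>)
  ultimately have "(\<lambda>v. \<nu> u * Der \<nu> u v + Der \<nu> u v * \<nu> u) = (\<lambda>_. 0)"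
    by (rule has_derivative_unique)
  then have "Der \<nu> u v = 0" for v using nz by (auto simp: fun_eq_iff)
  then have k: "h u * n v u = - \<mu> u * (x1 v u * v2 u - x2 v u * v1 u)" for v
    using Der_nu[OF uW, of v] by simp
  \<comment> \<open>After multiplication of \<open>k\<close> by \<open>\<nu> u\<close> and
    replacement of \<open>\<nu> u * n v u\<close>, the coefficients of \<open>x1\<close> and
    \<open>x2\<close> are compared; \<open>\<omega> u\<close> is the determinant of that
    comparison.\<close>
  have "\<omega> u * (h u * v1 u - \<mu> u * \<nu> u * v2 u) = 0" "\<omega> u * (h u * v2 u + \<mu> u * \<nu> u * v1 u) = 0"
    using k[of e1] k[of e2] normal_components(1)[OF uW, of e1] normal_components(1)[OF uW, of e2]
    unfolding \<omega>_def by algebra+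
  then have "h u * v1 u - \<mu> u * \<nu> u * v2 u = 0" "h u * v2 u + \<mu> u * \<nu> u * v1 u = 0"
    using area_nonzero[OF uW nz] by auto
  \<comment> \<open>\<open>h u\<close> is eliminated: \<open>v2 u\<close> times the first equation
    minus \<open>v1 u\<close> times the second. But the sum of squares is
    \<open>1 - (\<nu> u)\<^sup>2\<close>, that is 2/3.\<close>
  then have "\<mu> u * \<nu> u * ((v1 u)\<^sup>2 + (v2 u)\<^sup>2) = 0" by algebra
  then have "(v1 u)\<^sup>2 + (v2 u)\<^sup>2 = 0" using mu_nonzero[OF uW] nz by simp
  then show False using normal_components(2)[OF uW] nu_constant[OF u] by simp
qed

end

section \<open>Passage to charts\<close>

lemma chart_inverse:
  assumes "smooth_manifold M" "c \<in> atlas M" "x \<in> fst c"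
  shows "inv_into (fst c) (snd c) (snd c x) = x"
proof -
  have o: "openin (mtop M) (fst c)"
    and h: "homeomorphic_map (subtopology (mtop M) (fst c)) (top_of_set (coords c)) (snd c)"
    using assms by (auto simp: smooth_manifold_def)
  have "inj_on (snd c) (fst c)"
    using homeomorphic_imp_injective_map[OF h] openin_subset[OF o] by (simp add: Int_absorb1)
  then show ?thesis using assms(3) by simp
qed

lemma rep_chart:
  "smooth_manifold M \<Longrightarrow> c \<in> atlas M \<Longrightarrow> x \<in> fst c \<Longrightarrow> rep c d f (snd c x) = snd d (f x)"
  by (simp add: rep_def chart_inverse)

lemma rep_in_coords:
  assumes "smooth_manifold M" "c \<in> atlas M" "u \<in> rep_dom c d f"
  shows "rep c d f u \<in> coords d"
proof -
  obtain x where "x \<in> fst c" "f x \<in> fst d" "u = snd c x"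
    using assms(3) unfolding rep_dom_def by blast
  then show ?thesis using rep_chart[OF assms(1,2), of x d f] by (simp add: coords_def)
qed

lemma rep_dom_subset_coords: "rep_dom c d f \<subseteq> coords c"
  by (auto simp: rep_dom_def coords_def)

text \<open>The relevant part of the chart neighbourhood is open by continuity of \<open>f\<close>,
  and a chart, being a homeomorphism onto an open set, maps it to an open set.\<close>

lemma open_rep_dom:
  assumes M: "smooth_manifold M" "c \<in> atlas M" and N: "smooth_manifold N" "d \<in> atlas N"
    and f: "continuous_map (mtop M) (mtop N) f"
  shows "open (rep_dom c d f)"
proof -
  have o: "openin (mtop M) (fst c)" "open (coords c)"
    and h: "homeomorphic_map (subtopology (mtop M) (fst c)) (top_of_set (coords c)) (snd c)"
    using M by (auto simp: smooth_manifold_def)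
  have "openin (mtop N) (fst d)" using N by (auto simp: smooth_manifold_def)
  then have "openin (mtop M) {x \<in> topspace (mtop M). f x \<in> fst d}"
    using f openin_continuous_map_preimage by blast
  then have "openin (mtop M) (fst c \<inter> {x \<in> topspace (mtop M). f x \<in> fst d})"
    using o openin_Int by blast
  moreover have "fst c \<inter> {x \<in> topspace (mtop M). f x \<in> fst d} = fst c \<inter> f -` fst d"
    using openin_subset[OF o(1)] by auto
  ultimately have "openin (subtopology (mtop M) (fst c)) (fst c \<inter> f -` fst d)"
    by (simp add: openin_open_subtopology[OF o(1)])
  then have "openin (top_of_set (coords c)) (rep_dom c d f)"
    using homeomorphic_imp_open_map[OF h] by (simp add: open_map_def rep_dom_def)
  then show ?thesis using o(2) openin_open_trans by blast
qed

lemma coordinate_metric_gram: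
  assumes "riemannian_manifold M" "c \<in> atlas M" "open U" "U \<subseteq> coords c"
  shows "coordinate_metric (gram M c) U"
  using assms by unfold_locales (auto simp: riemannian_manifold_def intro: smooth_on_subset)

text \<open>The coordinate domain is cut down to the points projecting into the chart
  \<open>e\<close>, so that the coordinate expression of \<open>\<pi>\<close> takes values in
  \<open>coords e\<close>.\<close>

lemma unit_fibration_charts:
  assumes E: "E_space \<kappa> \<tau> M B \<pi> \<xi>" and d: "d \<in> atlas M" and e: "e \<in> atlas B"
  shows "unit_fibration (gram M d) (rep_dom d e \<pi>) (gram B e) (coords e) (rep d e \<pi>) (\<xi> d) \<kappa> \<tau>"
proof -
  have M: "riemannian_manifold M" and B: "riemannian_manifold B" and cc: "constant_curvature B \<kappa>"
    and sub: "riemannian_submersion M B \<pi>" and k: "killing_field M \<xi>"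
    and unit: "\<forall>c\<in>atlas M. \<forall>u\<in>coords c. ip (gram M c u) (\<xi> c u) (\<xi> c u) = 1"
    and vert: "\<forall>c\<in>atlas M. \<forall>d\<in>atlas B. \<forall>u\<in>rep_dom c d \<pi>. Der (rep c d \<pi>) u (\<xi> c u) = 0"
    and cov: "\<forall>c\<in>atlas M. \<forall>u\<in>coords c. \<forall>v. cov (gram M c) (\<xi> c) u v = \<tau> *\<^sub>R wedge (gram M c u) v (\<xi> c u)"
    using E by (auto simp: E_space_def space_form_surface_def)
  have sM: "smooth_manifold M" and sB: "smooth_manifold B"
    using M B by (auto simp: riemannian_manifold_def)
  have \<pi>: "smooth_map M B \<pi>" using sub by (simp add: riemannian_submersion_def)
  have o: "open (rep_dom d e \<pi>)"
    using open_rep_dom[OF sM d sB e] \<pi> by (simp add: smooth_map_def)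
  have oe: "open (coords e)" using sB e by (simp add: smooth_manifold_def)
  interpret tot: coordinate_metric "gram M d" "rep_dom d e \<pi>"
    by (rule coordinate_metric_gram[OF M d o rep_dom_subset_coords])
  interpret base: coordinate_metric "gram B e" "coords e"
    by (rule coordinate_metric_gram[OF B e oe]) simp
  have in_coords: "u \<in> coords d" if "u \<in> rep_dom d e \<pi>" for u
    using that rep_dom_subset_coords by blast
  have surj: "surj (Der (rep d e \<pi>) u)"
    and iso: "\<And>v w. (\<forall>k. Der (rep d e \<pi>) u k = 0 \<longrightarrow> ip (gram M d u) v k = 0) \<Longrightarrow>
      (\<forall>k. Der (rep d e \<pi>) u k = 0 \<longrightarrow> ip (gram M d u) w k = 0) \<Longrightarrow>
      ip (gram B e (rep d e \<pi> u)) (Der (rep d e \<pi>) u v) (Der (rep d e \<pi>) u w) = ip (gram M d u) v w"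
    if "u \<in> rep_dom d e \<pi>" for u
    using sub d e that unfolding riemannian_submersion_def Let_def by blast+
  show ?thesis
  proof unfold_locales
    show "smooth_on (rep_dom d e \<pi>) (rep d e \<pi>)" using \<pi> d e by (simp add: smooth_map_def)
    show "rep d e \<pi> ` rep_dom d e \<pi> \<subseteq> coords e" using rep_in_coords[OF sM d] by blast
    have "smooth_on (coords d) (\<xi> d)"
      using k d by (simp add: killing_field_def vector_field_def)
    then show "smooth_on (rep_dom d e \<pi>) (\<xi> d)"
      by (rule smooth_on_subset[OF _ rep_dom_subset_coords])
    show "ip (gram B e y) (curvature (gram B e) y a b b) a =
       \<kappa> * (ip (gram B e y) a a * ip (gram B e y) b b - (ip (gram B e y) a b)\<^sup>2)" if "y \<in> coords e" for y a b
      using cc e that by (simp add: constant_curvature_def)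
  qed (use surj iso unit vert cov d e in_coords in auto)
qed

lemma umbilic_factor:
  assumes "shape_operator G F N u E" "E = (\<lambda>v. mean_curvature E *\<^sub>R v)" "linear (Der F u)"
  shows "cov_along G F N u v = - mean_curvature E *\<^sub>R Der F u v"
proof -
  have "Der F u (E v) = - cov_along G F N u v" using assms(1) by (simp add: shape_operator_def)
  moreover have "Der F u (E v) = mean_curvature E *\<^sub>R Der F u v"
    using fun_cong[OF assms(2), of v] linear_cmul[OF assms(3)] by metis
  ultimately show ?thesis by simp
qed

theorem theorem4p4:
  fixes \<kappa> \<tau> :: real
    and M :: "('a, 3) riem" and B :: "('b, 2) riem" and \<pi> :: "'a \<Rightarrow> 'b" and \<xi> :: "('a, 3) vfield"
    and S :: "('s, 2) riem" and f :: "'s \<Rightarrow> 'a"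
  assumes "\<tau> \<noteq> 0" and "\<kappa> - 4 * \<tau>\<^sup>2 \<noteq> 0"
    and "E_space \<kappa> \<tau> M B \<pi> \<xi>"
    and "riemannian_manifold S" and "points S \<noteq> {}" and "isometric_immersion S M f"
  shows "\<not> totally_umbilic S M f"
proof
  assume tu: "totally_umbilic S M f"
  obtain x where xS: "x \<in> points S" using assms(5) by blast
  obtain c d W N where c: "c \<in> atlas S" and d: "d \<in> atlas M" and x: "x \<in> fst c" "snd c x \<in> W"
    and W: "open W" "W \<subseteq> rep_dom c d f" and N: "unit_normal_field (gram M d) (rep c d f) W N"
    and shape: "\<forall>u\<in>W. \<exists>E. shape_operator (gram M d) (rep c d f) N u E \<and> E = (\<lambda>v. mean_curvature E *\<^sub>R v)"
    using tu[unfolded totally_umbilic_def, rule_format, OF xS]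
    by - (elim bexE exE conjE, rule that)
  let ?F = "rep c d f"
  have sS: "smooth_manifold S" using assms(4) by (simp add: riemannian_manifold_def)
  have M: "riemannian_manifold M" and B: "riemannian_manifold B" and sub: "riemannian_submersion M B \<pi>"
    using assms(3) by (auto simp: E_space_def space_form_surface_def)
  have sM: "smooth_manifold M" and sB: "smooth_manifold B"
    using M B by (auto simp: riemannian_manifold_def)
  have F: "smooth_on (rep_dom c d f) ?F"
    using assms(6) c d by (simp add: isometric_immersion_def smooth_map_def)
  \<comment> \<open>Membership in \<open>rep_dom\<close> provides some point with the coordinates of
    \<open>x\<close>; injectivity of the chart identifies it with \<open>x\<close>.\<close>
  obtain x' where x': "x' \<in> fst c" "f x' \<in> fst d" "snd c x = snd c x'"
    using x W(2) by (auto simp: rep_dom_def)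
  then have fx: "f x \<in> fst d" using chart_inverse[OF sS c] x(1) by metis
  moreover have "openin (mtop M) (fst d)" using sM d by (simp add: smooth_manifold_def)
  ultimately have "f x \<in> points M" using openin_subset by blast
  then have "\<pi> (f x) \<in> points B" using sub by (auto simp: riemannian_submersion_def)
  moreover have "(\<Union>c\<in>atlas B. fst c) = points B" using sB by (simp add: smooth_manifold_def)
  ultimately obtain e where e: "e \<in> atlas B" "\<pi> (f x) \<in> fst e" by blast
  let ?p = "rep d e \<pi>"
  let ?U = "rep_dom d e \<pi>"
  interpret fib: unit_fibration "gram M d" ?U "gram B e" "coords e" ?p "\<xi> d" \<kappa> \<tau>
    by (rule unit_fibration_charts[OF assms(3) d e(1)])
  \<comment> \<open>Shrunk so that the projected surface stays in the base chart \<open>e\<close>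
    around \<open>\<pi> (f x)\<close>; the coordinates of \<open>x\<close> remain inside.\<close>
  define W' where "W' = W \<inter> ?F -` ?U"
  have FW: "smooth_on W ?F" by (rule smooth_on_subset[OF F W(2)])
  have W': "open W'" "W' \<subseteq> W" "?F ` W' \<subseteq> ?U"
    using continuous_open_preimage[OF smooth_on_continuous[OF FW] W(1) fib.tot.open_dom]
    by (auto simp: W'_def)
  have FW': "smooth_on W' ?F" by (rule smooth_on_subset[OF FW W'(2)])
  have "?F (snd c x) = snd d (f x)" by (rule rep_chart[OF sS c x(1)])
  then have "snd c x \<in> W'" using x(2) fx e(2) by (auto simp: W'_def rep_dom_def)
  have "\<exists>k. \<forall>v. cov_along (gram M d) ?F N u v = - k *\<^sub>R Der ?F u v" if u: "u \<in> W" for u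
  proof -
    obtain E where E: "shape_operator (gram M d) ?F N u E" "E = (\<lambda>v. mean_curvature E *\<^sub>R v)"
      using bspec[OF shape u] by (elim exE conjE)
    from umbilic_factor[OF E smooth_on_linear_Der[OF FW u]] show ?thesis by blast
  qed
  \<comment> \<open>A pointwise choice without any regularity; smoothness is recovered by
    \<open>h_smooth\<close> inside the locale.\<close>
  then obtain h where h: "\<forall>u\<in>W. \<forall>v. cov_along (gram M d) ?F N u v = - h u *\<^sub>R Der ?F u v"
    using bchoice[of W "\<lambda>u k. \<forall>v. cov_along (gram M d) ?F N u v = - k *\<^sub>R Der ?F u v"] by blast
  have sm: "smooth_on W' (\<lambda>u. gram B e (?p (?F u)))"
    by (rule smooth_on_compose[OF fib.tot.open_dom W'(1) W'(3) FW'
        smooth_on_compose[OF fib.base.open_dom fib.tot.open_dom fib.p_maps fib.p_smooth fib.base.smooth_gram]])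
  have pF: "?p (?F u) \<in> coords e" if "u \<in> W'" for u using W'(3) fib.p_maps that by blast
  obtain a b where ab: "smooth_on W' a" "smooth_on W' b"
    "\<And>u. u \<in> W' \<Longrightarrow> orthonormal (gram B e (?p (?F u))) (a u) (b u)"
    by (rule orthonormal_frame[OF W'(1) sm]) (use fib.base.gram_sym fib.base.gram_pos pF in blast)+
  have inj: "inj (Der ?F u)" if "u \<in> W'" for u
    using assms(6) c d that W(2) W'(2) unfolding isometric_immersion_def by blast
  interpret umbilic_surface "gram M d" ?U "gram B e" "coords e" ?p "\<xi> d" \<kappa> \<tau> ?F N W' h a b
    using N h W' FW' inj ab assms(1,2)
    by unfold_locales (auto simp: unit_normal_field_def intro: smooth_on_subset)
  show False using domain_empty \<open>snd c x \<in> W'\<close> by simp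
qed

end
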